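(* Let $(G,T)$ be a bipartite graft with color classes $A$ and $B$, let $F$ be a minimum join, and let $X\subseteq A$ be a maximal bipartitic extreme set. Then $X$ is $F$-combic and: (i) the set of connected components of $G[D_X]$ equals $\mathrm{Odd}_T(G-X)$; (ii) for every $C\in\mathrm{Odd}_T(G-X)$ and the vertex $r_C\in V(C)$ that is the end of the unique edge of $\delta_G(V(C))\cap F$, the graft $(C,(T\cap V(C))\,\Delta\,\{r_C\})$ is primal with respect to $r_C$, and $N_G(X)\cap V(C)\subseteq A_{(C,(T\cap V(C))\Delta\{r_C\})}(r_C)$; (iii) every member of $\mathrm{Even}_T(G-X)$ is a trivial factor-component of $(G,T)$ (i.e. consists of a single trivial vertex).
   Context: All graphs are finite (parallel edges allowed). A graft is a pair $(G,T)$ with $T\subseteq V(G)$; a join is $F\subseteq E(G)$ such that each vertex is incident to an odd number of edges of $F$ iff it lies in $T$; a minimum join is one of minimum size. A bipartite graft has $G$ bipartite with given color classes. For $F\subseteq E$ and a subgraph $Q$, $w_F(Q)=|E(Q)\setminus F|-|E(Q)\cap F|$; $\lambda_{(G,T),F}(x,y)$ is the minimum of $w_F(P)$ over paths $P$ between $x$ and $y$ ($0$ if $x=y$); for a minimum join $F$ it does not depend on the choice of $F$. $\delta_G(Y)$: edges with exactly one end in $Y$; $E_G[Y]$: edges with both ends in $Y$; $N_G(Y)$: vertices outside $Y$ adjacent to a vertex of $Y$. $\mathrm{Odd}_T(H)$ / $\mathrm{Even}_T(H)$: connected components $C$ of $H$ with $|V(C)\cap T|$ odd / even. $X$ is $F$-combic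 if $E_G[X]\cap F=\emptyset$, $|\delta_G(V(C))\cap F|=1$ for every $C\in\mathrm{Odd}_T(G-X)$, and $\delta_G(V(C))\cap F=\emptyset$ for every $C\in\mathrm{Even}_T(G-X)$. Extreme: $\lambda_{(G,T),F}(x,y)\ge0$ for all $x,y\in X$; bipartitic: also contained in a color class; maximal bipartitic extreme: not properly contained in another bipartitic extreme set. $D_X:=\{y\notin X:\min_{x\in X}\lambda_{(G,T),F}(x,y)<0\}$. A graft $(H,S)$ is primal with respect to $r\in V(H)$ if $\lambda_{(H,S),F'}(r,x)\le0$ for every $x\in V(H)$, $F'$ a minimum join; for a graft primal with respect to $r$, $A_{(H,S)}(r):=\{x\in V(H):\lambda_{(H,S),F'}(r,x)=0\}$. An edge is allowed if it lies in some minimum join; factor-components are the connected components of the spanning subgraph of allowed edges; a factor-component is trivial if it has one vertex, which is then called trivial. *)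

theory Defs
  imports "HOL-Library.Extended_Real"
begin

section \<open>Finite multigraphs\<close>

text \<open>
  Edges are abstract names, so parallel edges are allowed; \<open>ends\<close> gives the two ends of an edge.
  Loops are excluded (the graphs considered here are bipartite). A subgraph carries the same
  \<open>ends\<close> function as its supergraph, so equality of subgraphs is equality of vertex and edge sets.
\<close>

record ('v, 'e) mgraph =
  verts :: "'v set"
  edges :: "'e set"
  ends :: "'e \<Rightarrow> 'v set"

definition finite_mgraph :: "('v, 'e) mgraph \<Rightarrow> bool" where
  "finite_mgraph G \<longleftrightarrow> finite (verts G) \<and> finite (edges G) \<and>
     (\<forall>e\<in>edges G. ends G e \<subseteq> verts G \<and> card (ends G e) = 2)"

definition edge_cut :: "('v, 'e) mgraph \<Rightarrow> 'v set \<Rightarrow> 'e set" where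
  "edge_cut G Y = {e \<in> edges G. card (ends G e \<inter> Y) = 1}"

definition edges_within :: "('v, 'e) mgraph \<Rightarrow> 'v set \<Rightarrow> 'e set" where
  "edges_within G Y = {e \<in> edges G. ends G e \<subseteq> Y}"

definition nbhd :: "('v, 'e) mgraph \<Rightarrow> 'v set \<Rightarrow> 'v set" where
  "nbhd G Y = {v \<in> verts G - Y. \<exists>u\<in>Y. \<exists>e\<in>edges G. ends G e = {u, v}}"

definition induced :: "('v, 'e) mgraph \<Rightarrow> 'v set \<Rightarrow> ('v, 'e) mgraph" where
  "induced G Y = G\<lparr>verts := verts G \<inter> Y, edges := edges_within G Y\<rparr>"

definition delete_verts :: "('v, 'e) mgraph \<Rightarrow> 'v set \<Rightarrow> ('v, 'e) mgraph" where
  "delete_verts G Y = induced G (verts G - Y)"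

definition path_between ::
    "('v, 'e) mgraph \<Rightarrow> 'v \<Rightarrow> 'v \<Rightarrow> 'v list \<Rightarrow> 'e list \<Rightarrow> bool" where
  "path_between G x y vs es \<longleftrightarrow>
     vs \<noteq> [] \<and> hd vs = x \<and> last vs = y \<and> distinct vs \<and> set vs \<subseteq> verts G \<and>
     set es \<subseteq> edges G \<and> length vs = Suc (length es) \<and>
     (\<forall>i<length es. ends G (es ! i) = {vs ! i, vs ! Suc i})"

definition components :: "('v, 'e) mgraph \<Rightarrow> ('v, 'e) mgraph set" where
  "components G =
     {induced G {y. \<exists>vs es. path_between G x y vs es} | x. x \<in> verts G}"

definition odd_components :: "'v set \<Rightarrow> ('v, 'e) mgraph \<Rightarrow> ('v, 'e) mgraph set" where
  "odd_components T H = {C \<in> components H. odd (card (verts C \<inter> T))}"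

definition even_components :: "'v set \<Rightarrow> ('v, 'e) mgraph \<Rightarrow> ('v, 'e) mgraph set" where
  "even_components T H = {C \<in> components H. even (card (verts C \<inter> T))}"


section \<open>Grafts and joins\<close>

definition graft :: "('v, 'e) mgraph \<Rightarrow> 'v set \<Rightarrow> bool" where
  "graft G T \<longleftrightarrow> finite_mgraph G \<and> T \<subseteq> verts G"

definition bipartite_graft ::
    "('v, 'e) mgraph \<Rightarrow> 'v set \<Rightarrow> 'v set \<Rightarrow> 'v set \<Rightarrow> bool" where
  "bipartite_graft G T A B \<longleftrightarrow> graft G T \<and> A \<union> B = verts G \<and> A \<inter> B = {} \<and>
     (\<forall>e\<in>edges G. \<exists>a\<in>A. \<exists>b\<in>B. ends G e = {a, b})"

definition is_join :: "('v, 'e) mgraph \<Rightarrow> 'v set \<Rightarrow> 'e set \<Rightarrow> bool" where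
  "is_join G T F \<longleftrightarrow> F \<subseteq> edges G \<and>
     (\<forall>v\<in>verts G. odd (card {e \<in> F. v \<in> ends G e}) \<longleftrightarrow> v \<in> T)"

definition minimum_join :: "('v, 'e) mgraph \<Rightarrow> 'v set \<Rightarrow> 'e set \<Rightarrow> bool" where
  "minimum_join G T F \<longleftrightarrow> is_join G T F \<and> (\<forall>F'. is_join G T F' \<longrightarrow> card F \<le> card F')"

definition weight :: "'e set \<Rightarrow> 'e set \<Rightarrow> int" where
  "weight F M = int (card (M - F)) - int (card (M \<inter> F))"

text \<open>
  Extended-real valued: the distance is \<open>\<infinity>\<close> between vertices of different components, and
  otherwise the infimum is a minimum, as a finite graph has only finitely many paths.
  The set \<open>T\<close> enters only through the join \<open>F\<close>.
\<close>

definition join_dist :: "('v, 'e) mgraph \<Rightarrow> 'e set \<Rightarrow> 'v \<Rightarrow> 'v \<Rightarrow> ereal" where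
  "join_dist G F x y =
     (if x = y then 0
      else Inf {ereal (of_int (weight F (set es))) | vs es. path_between G x y vs es})"

definition combic :: "('v, 'e) mgraph \<Rightarrow> 'v set \<Rightarrow> 'e set \<Rightarrow> 'v set \<Rightarrow> bool" where
  "combic G T F X \<longleftrightarrow> edges_within G X \<inter> F = {} \<and>
     (\<forall>C\<in>odd_components T (delete_verts G X). card (edge_cut G (verts C) \<inter> F) = 1) \<and>
     (\<forall>C\<in>even_components T (delete_verts G X). edge_cut G (verts C) \<inter> F = {})"

definition extreme :: "('v, 'e) mgraph \<Rightarrow> 'e set \<Rightarrow> 'v set \<Rightarrow> bool" where
  "extreme G F X \<longleftrightarrow> X \<subseteq> verts G \<and> (\<forall>x\<in>X. \<forall>y\<in>X. join_dist G F x y \<ge> 0)"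

definition bipartitic_extreme ::
    "('v, 'e) mgraph \<Rightarrow> 'v set \<Rightarrow> 'v set \<Rightarrow> 'e set \<Rightarrow> 'v set \<Rightarrow> bool" where
  "bipartitic_extreme G A B F X \<longleftrightarrow> extreme G F X \<and> (X \<subseteq> A \<or> X \<subseteq> B)"

definition maximal_bipartitic_extreme ::
    "('v, 'e) mgraph \<Rightarrow> 'v set \<Rightarrow> 'v set \<Rightarrow> 'e set \<Rightarrow> 'v set \<Rightarrow> bool" where
  "maximal_bipartitic_extreme G A B F X \<longleftrightarrow> bipartitic_extreme G A B F X \<and>
     \<not> (\<exists>Y. X \<subset> Y \<and> bipartitic_extreme G A B F Y)"

definition neg_reach :: "('v, 'e) mgraph \<Rightarrow> 'e set \<Rightarrow> 'v set \<Rightarrow> 'v set" where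
  "neg_reach G F X = {y \<in> verts G - X. (INF x\<in>X. join_dist G F x y) < 0}"

text \<open>
  The distances do not depend on the choice of the minimum join, so quantifying over all minimum
  joins is the same as fixing one; that one exists is made part of being primal.
\<close>

definition primal :: "('v, 'e) mgraph \<Rightarrow> 'v set \<Rightarrow> 'v \<Rightarrow> bool" where
  "primal H S r \<longleftrightarrow> graft H S \<and> r \<in> verts H \<and> (\<exists>F. minimum_join H S F) \<and>
     (\<forall>F. minimum_join H S F \<longrightarrow> (\<forall>x\<in>verts H. join_dist H F r x \<le> 0))"

definition zero_set :: "('v, 'e) mgraph \<Rightarrow> 'v set \<Rightarrow> 'v \<Rightarrow> 'v set" where
  "zero_set H S r =
     {x \<in> verts H. \<forall>F. minimum_join H S F \<longrightarrow> join_dist H F r x = 0}"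

definition allowed_edges :: "('v, 'e) mgraph \<Rightarrow> 'v set \<Rightarrow> 'e set" where
  "allowed_edges G T = {e \<in> edges G. \<exists>F. minimum_join G T F \<and> e \<in> F}"

definition factor_components :: "('v, 'e) mgraph \<Rightarrow> 'v set \<Rightarrow> ('v, 'e) mgraph set" where
  "factor_components G T = components (G\<lparr>edges := allowed_edges G T\<rparr>)"

definition trivial_factor_component ::
    "('v, 'e) mgraph \<Rightarrow> 'v set \<Rightarrow> ('v, 'e) mgraph \<Rightarrow> bool" where
  "trivial_factor_component G T C \<longleftrightarrow> C \<in> factor_components G T \<and> card (verts C) = 1"

end

theory Submission
  imports Defs
begin

text \<open>
  Fix an odd set \<open>T\<^sub>0\<close> and let \<open>g v\<close> be the minimum size of a \<open>(T\<^sub>0 \<triangle> {v})\<close>-join; for a minimum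
  \<open>T\<close>-join \<open>F\<close> and \<open>T\<^sub>0 = T \<triangle> {x}\<close> the distance from \<open>x\<close> to \<open>v\<close> is \<open>g v - g x\<close>, which does not
  mention \<open>F\<close>. If \<open>b\<close> minimises \<open>g\<close>, a minimum \<open>(T\<^sub>0 \<triangle> {v})\<close>-join has no edge at \<open>b\<close> when \<open>v = b\<close>
  and exactly one otherwise. In a bipartite graph this makes the contraction of \<open>b\<close> with all its
  neighbours send minimum joins to minimum joins, as in Sebo's proof of his distance theorem. By
  induction, if \<open>g\<close> has a strict maximum at \<open>x\<close> and deleting \<open>x\<close> leaves a connected nonempty graph,
  a minimum \<open>(T\<^sub>0 \<triangle> {v})\<close>-join has exactly one edge at \<open>x\<close> when \<open>v = x\<close> and none otherwise.

  Since \<open>X\<close> is extreme, contracting it keeps \<open>F\<close> minimum, and by maximality every vertex of \<open>A\<close>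
  lies in \<open>X\<close> or in \<open>D\<^sub>X\<close>. Hence a component \<open>C\<close> of \<open>D\<^sub>X\<close> has all its neighbours in \<open>X\<close>, and the
  result above applies to \<open>C\<close> together with the contracted \<open>X\<close> as \<open>x\<close>: the case \<open>v = x\<close> gives the
  unique join edge leaving \<open>C\<close>, the case \<open>v \<in> C\<close> gives that \<open>C\<close> is primal. All other vertices outside
  \<open>X\<close> belong to \<open>B\<close> and are isolated once \<open>X\<close> is deleted.
\<close>

section \<open>Odd vertices of edge sets\<close>

definition odd_verts :: "('v, 'e) mgraph \<Rightarrow> 'e set \<Rightarrow> 'v set" where
  "odd_verts G J = {v. odd (card {e \<in> J. v \<in> ends G e})}"

definition bipartition :: "('v, 'e) mgraph \<Rightarrow> 'v set \<Rightarrow> bool" where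
  "bipartition G B \<longleftrightarrow> (\<forall>e\<in>edges G. card (ends G e \<inter> B) = 1)"

lemma odd_card_sym_diff:
  assumes "finite A" "finite B"
  shows "odd (card (sym_diff A B)) \<longleftrightarrow> odd (card A) \<noteq> odd (card B)"
proof -
  have "card (sym_diff A B) = card (A - B) + card (B - A)"
    using assms by (subst card_Un_disjoint) auto
  moreover have "card A = card (A - B) + card (A \<inter> B)"
    using assms by (metis card_Diff_subset_Int card_mono finite_Int inf_le1 le_add_diff_inverse2)
  moreover have "card B = card (B - A) + card (A \<inter> B)"
    using assms by (metis card_Diff_subset_Int card_mono finite_Int inf_le2 inf_commute le_add_diff_inverse2)
  ultimately show ?thesis by auto
qed

lemma odd_verts_empty [simp]: "odd_verts G {} = {}"
  by (simp add: odd_verts_def)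

lemma odd_verts_singleton [simp]: "odd_verts G {e} = ends G e"
proof -
  have "{e' \<in> {e}. v \<in> ends G e'} = (if v \<in> ends G e then {e} else {})" for v by auto
  then show ?thesis by (auto simp: odd_verts_def)
qed

lemma odd_verts_sym_diff:
  assumes "finite J" "finite K"
  shows "odd_verts G (sym_diff J K) = sym_diff (odd_verts G J) (odd_verts G K)"
proof -
  have "{e \<in> sym_diff J K. v \<in> ends G e} =
      sym_diff {e \<in> J. v \<in> ends G e} {e \<in> K. v \<in> ends G e}" for v by auto
  then have "odd (card {e \<in> sym_diff J K. v \<in> ends G e}) \<longleftrightarrow>
      odd (card {e \<in> J. v \<in> ends G e}) \<noteq> odd (card {e \<in> K. v \<in> ends G e})" for v
    using odd_card_sym_diff[of "{e \<in> J. v \<in> ends G e}" "{e \<in> K. v \<in> ends G e}"] assms by simp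
  then show ?thesis by (auto simp: odd_verts_def)
qed

lemma odd_verts_Un:
  assumes "finite J" "finite K" "J \<inter> K = {}"
  shows "odd_verts G (J \<union> K) = sym_diff (odd_verts G J) (odd_verts G K)"
proof -
  have "sym_diff J K = J \<union> K" using assms by auto
  then show ?thesis using odd_verts_sym_diff[of J K G] assms by simp
qed

lemma odd_verts_Diff:
  assumes "finite J" "K \<subseteq> J"
  shows "odd_verts G (J - K) = sym_diff (odd_verts G J) (odd_verts G K)"
proof -
  have "sym_diff J K = J - K" using assms by auto
  then show ?thesis using odd_verts_sym_diff[of J K G] assms finite_subset by metis
qed

lemma odd_verts_insert:
  assumes "finite J" "e \<notin> J"
  shows "odd_verts G (insert e J) = sym_diff (odd_verts G J) (ends G e)"
  using odd_verts_Un[of J "{e}" G] assms by simp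

lemma odd_verts_subset:
  assumes "finite_mgraph G" "J \<subseteq> edges G"
  shows "odd_verts G J \<subseteq> verts G"
proof
  fix v assume "v \<in> odd_verts G J"
  then have "{e \<in> J. v \<in> ends G e} \<noteq> {}"
    unfolding odd_verts_def by (metis (mono_tags, lifting) card.empty even_zero mem_Collect_eq)
  then show "v \<in> verts G" using assms by (auto simp: finite_mgraph_def)
qed

lemma finite_ends: "finite_mgraph G \<Longrightarrow> e \<in> edges G \<Longrightarrow> finite (ends G e)"
  by (metis finite_mgraph_def card.infinite zero_neq_numeral)

lemma ends_eq_doubleton:
  assumes "finite_mgraph G" "e \<in> edges G" "p \<in> ends G e" "q \<in> ends G e" "p \<noteq> q"
  shows "ends G e = {p, q}"
  using assms card_subset_eq[of "ends G e" "{p, q}"] finite_ends[of G e]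
  by (auto simp: finite_mgraph_def)

lemma ends_other:
  assumes "finite_mgraph G" "e \<in> edges G" "p \<in> ends G e"
  obtains q where "ends G e = {p, q}" "p \<noteq> q" "q \<in> verts G"
proof -
  have "card (ends G e - {p}) = 1" using assms finite_ends[of G e] by (auto simp: finite_mgraph_def)
  then obtain q where "ends G e - {p} = {q}" by (auto simp: card_1_singleton_iff)
  then have "q \<in> ends G e" "p \<noteq> q" by auto
  moreover from this have "ends G e = {p, q}" using ends_eq_doubleton[OF assms(1-3)] by blast
  ultimately show ?thesis using that assms by (auto simp: finite_mgraph_def)
qed

lemma finite_edge_set: "finite_mgraph G \<Longrightarrow> J \<subseteq> edges G \<Longrightarrow> finite J"
  by (metis finite_mgraph_def finite_subset)

lemma even_card_odd_verts_Int:
  assumes "finite_mgraph G" "J \<subseteq> edges G"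
  shows "even (card (odd_verts G J \<inter> Y)) \<longleftrightarrow> even (\<Sum>e\<in>J. card (ends G e \<inter> Y))"
proof -
  have "finite J" using assms finite_edge_set by blast
  then show ?thesis using assms(2)
  proof (induction J rule: finite_induct)
    case empty
    then show ?case by simp
  next
    case (insert e J)
    have f: "finite (odd_verts G J)" "finite (ends G e)"
      using odd_verts_subset[of G J] assms(1) insert.prems finite_ends[of G e]
      by (auto simp: finite_mgraph_def intro: finite_subset)
    have "odd_verts G (insert e J) \<inter> Y = sym_diff (odd_verts G J \<inter> Y) (ends G e \<inter> Y)"
      using odd_verts_insert[of J e G] insert.hyps by auto
    then have "odd (card (odd_verts G (insert e J) \<inter> Y)) \<longleftrightarrow>
        odd (card (odd_verts G J \<inter> Y)) \<noteq> odd (card (ends G e \<inter> Y))"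
      using odd_card_sym_diff[of "odd_verts G J \<inter> Y" "ends G e \<inter> Y"] f by simp
    then show ?case using insert.IH insert.prems insert.hyps by (auto simp: even_add)
  qed
qed

lemma even_card_odd_verts:
  assumes "finite_mgraph G" "J \<subseteq> edges G"
  shows "even (card (odd_verts G J))"
proof -
  have "even (\<Sum>e\<in>J. card (ends G e \<inter> UNIV))"
    using assms by (intro dvd_sum) (auto simp: finite_mgraph_def)
  then show ?thesis using even_card_odd_verts_Int[OF assms, of UNIV] by simp
qed

lemma even_card_bipartition:
  assumes "finite_mgraph G" "J \<subseteq> edges G" "bipartition G B"
  shows "even (card (odd_verts G J \<inter> B)) \<longleftrightarrow> even (card J)"
proof -
  have "(\<Sum>e\<in>J. card (ends G e \<inter> B)) = (\<Sum>e\<in>J. 1)"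
    using assms by (intro sum.cong) (auto simp: bipartition_def)
  then show ?thesis using even_card_odd_verts_Int[OF assms(1,2), of B] by simp
qed

lemma even_card_edge_cut:
  assumes "finite_mgraph G" "J \<subseteq> edges G"
  shows "even (card (odd_verts G J \<inter> Y)) \<longleftrightarrow> even (card (edge_cut G Y \<inter> J))"
proof -
  have fJ: "finite J" using assms finite_edge_set by blast
  have 1: "card (ends G e \<inter> Y) \<le> 2" if "e \<in> J" for e
    using that assms card_mono[of "ends G e" "ends G e \<inter> Y"] finite_ends[of G e]
    by (auto simp: finite_mgraph_def)
  have "(\<Sum>e\<in>J. card (ends G e \<inter> Y)) =
     (\<Sum>e\<in>edge_cut G Y \<inter> J. card (ends G e \<inter> Y)) + (\<Sum>e\<in>J - edge_cut G Y. card (ends G e \<inter> Y))"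
    using sum.Int_Diff[OF fJ, of "\<lambda>e. card (ends G e \<inter> Y)" "edge_cut G Y"]
    by (simp only: Int_commute)
  moreover have "(\<Sum>e\<in>edge_cut G Y \<inter> J. card (ends G e \<inter> Y)) = card (edge_cut G Y \<inter> J)"
    by (simp add: edge_cut_def)
  moreover have "even (\<Sum>e\<in>J - edge_cut G Y. card (ends G e \<inter> Y))"
  proof (intro dvd_sum)
    fix e assume e: "e \<in> J - edge_cut G Y"
    then have "card (ends G e \<inter> Y) \<noteq> 1" using assms by (auto simp: edge_cut_def)
    then have "card (ends G e \<inter> Y) = 0 \<or> card (ends G e \<inter> Y) = 2" using 1[of e] e by fastforce
    then show "even (card (ends G e \<inter> Y))" by auto
  qed
  ultimately show ?thesis using even_card_odd_verts_Int[OF assms, of Y] by simp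
qed

lemma weight_Un:
  assumes "finite P" "finite Q" "P \<inter> Q = {}"
  shows "weight F (P \<union> Q) = weight F P + weight F Q"
proof -
  have "card ((P \<union> Q) - F) = card (P - F) + card (Q - F)"
    using assms by (subst card_Un_disjoint[symmetric]) (auto simp: Un_Diff)
  moreover have "card ((P \<union> Q) \<inter> F) = card (P \<inter> F) + card (Q \<inter> F)"
    using assms by (subst card_Un_disjoint[symmetric]) (auto simp: Int_Un_distrib2)
  ultimately show ?thesis by (simp add: weight_def)
qed

lemma weight_Diff:
  assumes "finite Q" "P \<subseteq> Q"
  shows "weight F (Q - P) = weight F Q - weight F P"
proof -
  have "P \<union> (Q - P) = Q" using assms by auto
  then show ?thesis
    using weight_Un[of P "Q - P" F] assms finite_subset[of P Q] by auto
qed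

lemma weight_singleton: "weight F {e} = (if e \<in> F then -1 else 1)"
  by (auto simp: weight_def insert_Diff_if)

lemma weight_insert:
  assumes "finite P" "e \<notin> P"
  shows "weight F (insert e P) = weight F P + (if e \<in> F then -1 else 1)"
  using weight_Un[of P "{e}" F] assms by (simp add: weight_singleton)

lemma even_weight: "finite P \<Longrightarrow> even (weight F P) \<longleftrightarrow> even (card P)"
proof -
  assume "finite P"
  then have "card P = card (P - F) + card (P \<inter> F)"
    by (metis card_Diff_subset_Int card_mono finite_Int inf_le1 le_add_diff_inverse2)
  then show ?thesis by (simp add: weight_def)
qed

lemma card_sym_diff_weight:
  assumes "finite F" "finite P"
  shows "int (card (sym_diff F P)) = int (card F) + weight F P"
proof -
  have "card (sym_diff F P) = card (F - P) + card (P - F)"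
    using assms by (subst card_Un_disjoint) auto
  moreover have "card F = card (F - P) + card (P \<inter> F)"
    using assms by (metis card_Diff_subset_Int card_mono finite_Int inf_le2 inf_commute le_add_diff_inverse2)
  ultimately show ?thesis by (simp add: weight_def)
qed

text \<open>Follow a trail in \<open>J\<close> from \<open>x\<close> and stop it on its first visit to \<open>S\<close>.\<close>

lemma odd_verts_trail:
  assumes "finite_mgraph G" "J \<subseteq> edges G" "x \<in> odd_verts G J" "x \<notin> S"
  obtains P y where "P \<subseteq> J" "y \<noteq> x" "y \<in> odd_verts G J \<union> S" "odd_verts G P = {x, y}"
    "card {e \<in> P. ends G e \<inter> S \<noteq> {}} = (if y \<in> S then 1 else 0)"
proof -
  have "finite J" using assms finite_edge_set by blast
  then have "\<exists>P y. P \<subseteq> J \<and> y \<noteq> x \<and> y \<in> odd_verts G J \<union> S \<and> odd_verts G P = {x, y} \<and>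
    card {e \<in> P. ends G e \<inter> S \<noteq> {}} = (if y \<in> S then 1 else 0)"
    using assms(2-4)
  proof (induction J arbitrary: x rule: finite_psubset_induct)
    case (psubset J)
    have "{e \<in> J. x \<in> ends G e} \<noteq> {}"
      using psubset.prems unfolding odd_verts_def
      by (metis (mono_tags, lifting) card.empty even_zero mem_Collect_eq)
    then obtain e where e: "e \<in> J" "x \<in> ends G e" by blast
    then have "card (ends G e) = 2" using assms(1) psubset.prems by (auto simp: finite_mgraph_def)
    then obtain x' where x': "ends G e = {x, x'}" "x' \<noteq> x"
      using e(2) by (metis card_2_iff doubleton_eq_iff insertE singletonD)
    show ?case
    proof (cases "x' \<in> odd_verts G J \<union> S")
      case True
      have "{e' \<in> {e}. ends G e' \<inter> S \<noteq> {}} = (if x' \<in> S then {e} else {})"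
        using x' psubset.prems(3) by auto
      then have "card {e' \<in> {e}. ends G e' \<inter> S \<noteq> {}} = (if x' \<in> S then 1 else 0)" by simp
      then show ?thesis using e x' True by (intro exI[of _ "{e}"] exI[of _ x']) auto
    next
      case False
      have od: "odd_verts G (J - {e}) = sym_diff (odd_verts G J) {x, x'}"
        using odd_verts_Diff[of J "{e}" G] psubset.hyps e x' by auto
      have "\<exists>P y. P \<subseteq> J - {e} \<and> y \<noteq> x' \<and> y \<in> odd_verts G (J - {e}) \<union> S \<and> odd_verts G P = {x', y} \<and>
          card {e \<in> P. ends G e \<inter> S \<noteq> {}} = (if y \<in> S then 1 else 0)"
        using psubset.prems e False od x' by (intro psubset.IH) auto
      then obtain P y where P: "P \<subseteq> J - {e}" "y \<noteq> x'" "y \<in> odd_verts G (J - {e}) \<union> S"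
        "odd_verts G P = {x', y}" "card {e \<in> P. ends G e \<inter> S \<noteq> {}} = (if y \<in> S then 1 else 0)"
        by blast
      have y: "y \<noteq> x" "y \<in> odd_verts G J \<union> S" using P od psubset.prems by auto
      have "finite P" using P(1) psubset.hyps finite_subset by blast
      then have "odd_verts G (insert e P) = {x, y}"
        using odd_verts_insert[of P e G] P x' y by auto
      moreover have "{e' \<in> insert e P. ends G e' \<inter> S \<noteq> {}} = {e' \<in> P. ends G e' \<inter> S \<noteq> {}}"
        using x' False psubset.prems by auto
      ultimately show ?thesis using P y e
        by (intro exI[of _ "insert e P"] exI[of _ y]) auto
    qed
  qed
  then show ?thesis using that by blast
qed

lemma odd_verts_pair:
  assumes "finite_mgraph G" "J \<subseteq> edges G" "x \<in> odd_verts G J"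
  obtains P y where "P \<subseteq> J" "y \<noteq> x" "y \<in> odd_verts G J" "odd_verts G P = {x, y}"
  using odd_verts_trail[OF assms, of "{}"] by (metis Un_empty_right empty_iff)

lemma is_join_iff:
  assumes "finite_mgraph G" "T \<subseteq> verts G"
  shows "is_join G T F \<longleftrightarrow> F \<subseteq> edges G \<and> odd_verts G F = T"
  using odd_verts_subset[OF assms(1), of F] assms(2) by (auto simp: is_join_def odd_verts_def)

section \<open>Minimum joins\<close>

definition join_number :: "('v, 'e) mgraph \<Rightarrow> 'v set \<Rightarrow> nat" where
  "join_number G T = (LEAST k. \<exists>F. is_join G T F \<and> card F = k)"

lemma join_number_le: "is_join G T F \<Longrightarrow> join_number G T \<le> card F"
  unfolding join_number_def by (rule Least_le) blast

lemma obtains_minimum_join: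
  assumes "is_join G T F"
  obtains M where "minimum_join G T M" "card M = join_number G T"
proof -
  have "\<exists>M. is_join G T M \<and> card M = join_number G T"
    unfolding join_number_def by (rule LeastI_ex) (use assms in blast)
  then show ?thesis using that join_number_le unfolding minimum_join_def by metis
qed

lemma minimum_join_iff:
  "minimum_join G T M \<longleftrightarrow> is_join G T M \<and> card M = join_number G T"
  by (metis join_number_le minimum_join_def obtains_minimum_join le_antisym)

lemma is_join_switch:
  assumes "finite_mgraph G" "T \<subseteq> verts G" "is_join G T M" "Z \<subseteq> edges G"
  shows "is_join G (sym_diff T (odd_verts G Z)) (sym_diff M Z)"
proof -
  have M: "M \<subseteq> edges G" "odd_verts G M = T" using assms is_join_iff by blast+
  have "odd_verts G (sym_diff M Z) = sym_diff T (odd_verts G Z)"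
    using odd_verts_sym_diff[of M Z G] M assms finite_edge_set by metis
  moreover have "sym_diff T (odd_verts G Z) \<subseteq> verts G"
    using odd_verts_subset[OF assms(1,4)] assms by auto
  moreover have "sym_diff M Z \<subseteq> edges G" using M assms by auto
  ultimately show ?thesis using is_join_iff[OF assms(1)] by simp
qed

lemma weight_even_nonneg:
  assumes "finite_mgraph G" "T \<subseteq> verts G" "minimum_join G T M" "Z \<subseteq> edges G" "odd_verts G Z = {}"
  shows "weight M Z \<ge> 0"
proof -
  have "is_join G T (sym_diff M Z)"
    using is_join_switch[of G T M Z] assms by (simp add: minimum_join_def)
  then have "card M \<le> card (sym_diff M Z)" using assms by (simp add: minimum_join_def)
  moreover have "finite M" "finite Z"
    using assms finite_edge_set by (auto simp: minimum_join_def is_join_def)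
  ultimately show ?thesis using card_sym_diff_weight[of M Z] by simp
qed

lemma minimum_joinI_weight:
  assumes "finite_mgraph G" "T \<subseteq> verts G" "is_join G T M"
    and "\<And>Z. Z \<subseteq> edges G \<Longrightarrow> odd_verts G Z = {} \<Longrightarrow> weight M Z \<ge> 0"
  shows "minimum_join G T M"
  unfolding minimum_join_def
proof (intro conjI allI impI)
  fix M' assume M': "is_join G T M'"
  have f: "M \<subseteq> edges G" "M' \<subseteq> edges G" "finite M" "finite M'"
      "odd_verts G M = T" "odd_verts G M' = T"
    using assms M' finite_edge_set is_join_iff by metis+
  have "weight M (sym_diff M M') \<ge> 0"
    using assms(4)[of "sym_diff M M'"] odd_verts_sym_diff[of M M' G] f by auto
  moreover have "sym_diff M (sym_diff M M') = M'" by auto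
  ultimately show "card M \<le> card M'"
    using card_sym_diff_weight[of M "sym_diff M M'"] f by simp
qed (use assms in simp)

lemma minimum_join_switch:
  assumes "finite_mgraph G" "T \<subseteq> verts G" "minimum_join G T M" "Z \<subseteq> edges G"
    "odd_verts G Z = {}" "weight M Z = 0"
  shows "minimum_join G T (sym_diff M Z)"
proof -
  have "is_join G T (sym_diff M Z)"
    using is_join_switch[of G T M Z] assms by (simp add: minimum_join_def)
  moreover have "finite M" "finite Z"
    using assms finite_edge_set by (auto simp: minimum_join_def is_join_def)
  then have "card (sym_diff M Z) = card M" using card_sym_diff_weight[of M Z] assms by simp
  ultimately show ?thesis using assms(3) by (simp add: minimum_join_def)
qed

section \<open>Contraction around a lowest vertex\<close>

text \<open>The image of a vertex set as a chain modulo 2: points with an even fibre cancel.\<close>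

definition push :: "('v \<Rightarrow> 'w) \<Rightarrow> 'v set \<Rightarrow> 'w set" where
  "push f S = {w. odd (card {v \<in> S. f v = w})}"

lemma push_empty [simp]: "push f {} = {}"
  by (simp add: push_def)

lemma push_sym_diff:
  assumes "finite S" "finite R"
  shows "push f (sym_diff S R) = sym_diff (push f S) (push f R)"
proof -
  have "{v \<in> sym_diff S R. f v = w} = sym_diff {v \<in> S. f v = w} {v \<in> R. f v = w}" for w by auto
  then have "odd (card {v \<in> sym_diff S R. f v = w}) \<longleftrightarrow>
      odd (card {v \<in> S. f v = w}) \<noteq> odd (card {v \<in> R. f v = w})" for w
    using odd_card_sym_diff[of "{v \<in> S. f v = w}" "{v \<in> R. f v = w}"] assms by simp
  then show ?thesis by (auto simp: push_def)
qed

lemma push_singleton [simp]: "push f {a} = {f a}"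
proof -
  have "{v \<in> {a}. f v = w} = (if f a = w then {a} else {})" for w by auto
  then show ?thesis by (auto simp: push_def)
qed

lemma push_doubleton: "a \<noteq> b \<Longrightarrow> push f {a, b} = sym_diff {f a} {f b}"
  using push_sym_diff[of "{a}" "{b}" f] by (simp add: insert_Diff_if insert_commute)

lemma push_subset: "push f S \<subseteq> f ` S"
proof
  fix w assume "w \<in> push f S"
  then have "{v \<in> S. f v = w} \<noteq> {}"
    unfolding push_def by (metis (mono_tags, lifting) card.empty even_zero mem_Collect_eq)
  then show "w \<in> f ` S" by auto
qed

lemma push_fibre: "(\<And>v. f v = w \<longleftrightarrow> v = u) \<Longrightarrow> w \<in> push f S \<longleftrightarrow> u \<in> S"
proof -
  assume "\<And>v. f v = w \<longleftrightarrow> v = u"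
  then have "{v \<in> S. f v = w} = (if u \<in> S then {u} else {})" by auto
  then show ?thesis by (simp add: push_def)
qed

text \<open>
  Edges that \<open>f\<close> collapses would be left with a single end; \<open>E\<close> has to leave them out.
\<close>

definition image_graph :: "('v \<Rightarrow> 'v) \<Rightarrow> 'e set \<Rightarrow> ('v, 'e) mgraph \<Rightarrow> ('v, 'e) mgraph" where
  "image_graph f E G = \<lparr>verts = f ` verts G, edges = E, ends = (\<lambda>e. f ` ends G e)\<rparr>"

lemma odd_verts_image_graph:
  assumes "finite_mgraph G" "J \<subseteq> edges G"
  shows "odd_verts (image_graph f E G) {e \<in> J. inj_on f (ends G e)} = push f (odd_verts G J)"
proof -
  have "finite J" using assms finite_edge_set by blast
  then show ?thesis using assms(2)
  proof (induction J rule: finite_induct)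
    case empty
    then show ?case by simp
  next
    case (insert e J)
    let ?H = "image_graph f E G"
    have fin: "finite (odd_verts G J)" "finite (ends G e)"
      using odd_verts_subset[of G J] assms(1) insert.prems finite_ends[of G e]
      by (auto simp: finite_mgraph_def intro: finite_subset)
    have "card (ends G e) = 2" using assms(1) insert.prems by (auto simp: finite_mgraph_def)
    then obtain p q where pq: "ends G e = {p, q}" "p \<noteq> q" by (auto simp: card_2_iff)
    have *: "push f (odd_verts G (insert e J)) = sym_diff (push f (odd_verts G J)) (push f {p, q})"
      using odd_verts_insert[of J e G] insert.hyps pq push_sym_diff[of "odd_verts G J" "{p,q}" f] fin
      by simp
    show ?case
    proof (cases "f p = f q")
      case True
      then have "{e' \<in> insert e J. inj_on f (ends G e')} = {e' \<in> J. inj_on f (ends G e')}"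
        using pq by auto
      then show ?thesis using * push_doubleton[of p q f] True pq insert by simp
    next
      case False
      then have 1: "{e' \<in> insert e J. inj_on f (ends G e')} = insert e {e' \<in> J. inj_on f (ends G e')}"
        using pq by auto
      have 2: "ends ?H e = {f p, f q}" "push f {p, q} = {f p, f q}"
        using pq push_doubleton[of p q f] False by (auto simp: image_graph_def)
      have "odd_verts ?H (insert e {e' \<in> J. inj_on f (ends G e')}) =
          sym_diff (odd_verts ?H {e' \<in> J. inj_on f (ends G e')}) {f p, f q}"
        using odd_verts_insert[of "{e' \<in> J. inj_on f (ends G e')}" e ?H] insert.hyps 2 by simp
      then show ?thesis using 1 2 * insert by simp
    qed
  qed
qed

lemma odd_verts_image_graph_inj:
  assumes "finite_mgraph G" "J \<subseteq> edges G" "\<And>e. e \<in> J \<Longrightarrow> inj_on f (ends G e)"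
  shows "odd_verts (image_graph f E G) J = push f (odd_verts G J)"
proof -
  have "{e \<in> J. inj_on f (ends G e)} = J" using assms(3) by auto
  then show ?thesis using odd_verts_image_graph[OF assms(1,2), of f E] by simp
qed

lemma finite_mgraph_image_graph:
  assumes "finite_mgraph G" "E \<subseteq> edges G" "\<And>e. e \<in> E \<Longrightarrow> inj_on f (ends G e)"
  shows "finite_mgraph (image_graph f E G)"
  using assms by (auto simp: finite_mgraph_def image_graph_def card_image intro: finite_subset)
    (metis image_eqI subsetD)+

locale lowest_vertex =
  fixes G :: "('v, 'e) mgraph" and T B :: "'v set" and b :: 'v
  assumes fin: "finite_mgraph G"
    and bip: "bipartition G B"
    and T: "T \<subseteq> verts G"
    and b: "b \<in> verts G"
    and ex: "\<And>v. v \<in> verts G \<Longrightarrow> \<exists>M. is_join G (sym_diff T {v}) M"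
    and low: "\<And>v. v \<in> verts G \<Longrightarrow> join_number G (sym_diff T {b}) \<le> join_number G (sym_diff T {v})"
begin

lemma T_diff: "v \<in> verts G \<Longrightarrow> sym_diff T {v} \<subseteq> verts G"
  using T by auto

lemma is_join_T_diff:
  "v \<in> verts G \<Longrightarrow> is_join G (sym_diff T {v}) M \<longleftrightarrow> M \<subseteq> edges G \<and> odd_verts G M = sym_diff T {v}"
  using is_join_iff[OF fin T_diff] .

lemma no_edge_at_lowest:
  assumes M: "minimum_join G (sym_diff T {b}) M" and e: "e \<in> M"
  shows "b \<notin> ends G e"
proof
  assume be: "b \<in> ends G e"
  have M': "M \<subseteq> edges G" "odd_verts G M = sym_diff T {b}" "card M = join_number G (sym_diff T {b})"
    using M is_join_T_diff[OF b] minimum_join_iff[of G "sym_diff T {b}" M] by blast+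
  then have "ends G e \<subseteq> verts G" "card (ends G e) = 2" using fin e by (auto simp: finite_mgraph_def)
  then obtain c where c: "ends G e = {b, c}" "c \<noteq> b" "c \<in> verts G"
    using be by (metis card_2_iff doubleton_eq_iff insertE singletonD insert_subset)
  have fM: "finite M" using M' fin finite_edge_set by blast
  have "odd_verts G (M - {e}) = sym_diff (sym_diff T {b}) {b, c}"
    using odd_verts_Diff[of M "{e}" G] fM e M' c by simp
  also have "\<dots> = sym_diff T {c}" using c by auto
  finally have "is_join G (sym_diff T {c}) (M - {e})"
    using is_join_T_diff[OF c(3)] M' by auto
  then have "join_number G (sym_diff T {c}) \<le> card (M - {e})" by (rule join_number_le)
  moreover have "card (M - {e}) < card M" using fM e by (meson card_Diff1_less)
  ultimately show False using low[OF c(3)] M' by simp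
qed

lemma one_edge_at_lowest:
  assumes v: "v \<in> verts G" "v \<noteq> b" and M: "minimum_join G (sym_diff T {v}) M"
  shows "card {e \<in> M. b \<in> ends G e} = 1"
proof -
  obtain F where "is_join G (sym_diff T {b}) F" using ex[OF b] by blast
  then obtain N where N: "minimum_join G (sym_diff T {b}) N" by (rule obtains_minimum_join)
  have M': "M \<subseteq> edges G" "odd_verts G M = sym_diff T {v}" "finite M"
      and N': "N \<subseteq> edges G" "odd_verts G N = sym_diff T {b}" "finite N"
    using M N is_join_T_diff[OF v(1)] is_join_T_diff[OF b] finite_edge_set[OF fin]
    by (auto simp: minimum_join_def)
  have Z: "sym_diff M N \<subseteq> edges G" "odd_verts G (sym_diff M N) = {v, b}"
    using M' N' odd_verts_sym_diff[of M N G] v by auto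
  obtain P y where P: "P \<subseteq> sym_diff M N" "y \<noteq> v" "y \<in> {v, b}" "odd_verts G P = {v, y}"
     "card {e \<in> P. ends G e \<inter> {b} \<noteq> {}} = (if y \<in> {b} then 1 else 0)"
    using odd_verts_trail[OF fin Z(1), of v "{b}"] Z(2) v by auto
  have Pb: "odd_verts G P = {v, b}" "card {e \<in> P. b \<in> ends G e} = 1" using P by auto
  have PE: "P \<subseteq> edges G" "finite P" using P Z finite_edge_set[OF fin] by blast+
  have "sym_diff (sym_diff T {v}) {v, b} = sym_diff T {b}"
    "sym_diff (sym_diff T {b}) {v, b} = sym_diff T {v}" using v by auto
  then have j: "is_join G (sym_diff T {b}) (sym_diff M P)" "is_join G (sym_diff T {v}) (sym_diff N P)"
    using is_join_switch[OF fin T_diff[OF v(1)] _ PE(1)] is_join_switch[OF fin T_diff[OF b] _ PE(1)]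
      M N Pb by (metis minimum_join_def)+
  have w: "weight N P = - weight M P"
  proof -
    have "P - N = P \<inter> M" "P \<inter> N = P - M" using P by auto
    then show ?thesis by (simp add: weight_def)
  qed
  have "card N \<le> card (sym_diff M P)" "card M \<le> card (sym_diff N P)"
    using j M N by (auto simp: minimum_join_def)
  then have "card (sym_diff M P) = card N"
    using card_sym_diff_weight[of M P] card_sym_diff_weight[of N P] w M' N' PE by simp
  then have "minimum_join G (sym_diff T {b}) (sym_diff M P)"
    using j N by (simp add: minimum_join_def)
  then have "\<forall>e\<in>sym_diff M P. b \<notin> ends G e" using no_edge_at_lowest by blast
  then have "{e \<in> M. b \<in> ends G e} = {e \<in> P. b \<in> ends G e}" by auto
  then show ?thesis using Pb by simp
qed

definition star :: "'e set" where
  "star = {e \<in> edges G. b \<in> ends G e}"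

definition contr :: "'v \<Rightarrow> 'v" where
  "contr v = (if v \<in> nbhd G {b} then b else v)"

definition contracted :: "('v, 'e) mgraph" where
  "contracted = image_graph contr (edges G - star) G"

lemma edge_ends:
  assumes "e \<in> edges G"
  obtains p q where "ends G e = {p, q}" "p \<noteq> q" "p \<in> B" "q \<notin> B" "p \<in> verts G" "q \<in> verts G"
proof -
  have "card (ends G e) = 2" "ends G e \<subseteq> verts G" "card (ends G e \<inter> B) = 1"
    using assms fin bip by (auto simp: finite_mgraph_def bipartition_def)
  moreover from this obtain p q where pq: "ends G e = {p, q}" "p \<noteq> q" by (auto simp: card_2_iff)
  moreover have "(p \<in> B) \<noteq> (q \<in> B)"
  proof
    assume "(p \<in> B) = (q \<in> B)"
    then have "ends G e \<inter> B = ends G e \<or> ends G e \<inter> B = {}" using pq by auto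
    then show False using calculation by auto
  qed
  ultimately show ?thesis using that by (metis insert_commute insert_subset)
qed

lemma nbhd_b: "v \<in> nbhd G {b} \<longleftrightarrow> (\<exists>e\<in>edges G. ends G e = {b, v})"
proof -
  have "v \<in> verts G" "v \<noteq> b" if "e \<in> edges G" "ends G e = {b, v}" for e
    using that fin by (auto simp: finite_mgraph_def doubleton_eq_iff)
  then show ?thesis by (auto simp: nbhd_def)
qed

lemma nbhd_color: "v \<in> nbhd G {b} \<Longrightarrow> v \<in> B \<longleftrightarrow> b \<notin> B"
proof -
  assume "v \<in> nbhd G {b}"
  then obtain e where "e \<in> edges G" "ends G e = {b, v}" using nbhd_b by blast
  then show ?thesis by (metis doubleton_eq_iff edge_ends)
qed

lemma inj_on_contr: "e \<in> edges G \<Longrightarrow> inj_on contr (ends G e) \<longleftrightarrow> e \<notin> star"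
proof -
  assume e: "e \<in> edges G"
  then obtain p q where pq: "ends G e = {p, q}" "p \<noteq> q" "p \<in> B" "q \<notin> B" using edge_ends by metis
  have 1: "\<not> (p \<in> nbhd G {b} \<and> q \<in> nbhd G {b})" using nbhd_color pq by blast
  have 2: "b \<notin> nbhd G {b}" by (simp add: nbhd_def)
  have 3: "q \<in> nbhd G {b}" if "p = b" using that nbhd_b e pq by blast
  have 4: "p \<in> nbhd G {b}" if "q = b" using that nbhd_b e pq by (metis insert_commute)
  show ?thesis using pq 1 2 3 4 e by (auto simp: contr_def star_def)
qed

lemma finite_contracted: "finite_mgraph contracted"
  unfolding contracted_def using fin inj_on_contr by (intro finite_mgraph_image_graph) auto

lemma bipartition_contracted: "\<exists>B'. bipartition contracted B'"
proof -
  have "\<exists>B'. bipartition G B' \<and> b \<in> B'"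
  proof (cases "b \<in> B")
    case False
    have "card (ends G e \<inter> - B) = 1" if ee: "e \<in> edges G" for e
    proof -
      obtain p q where "ends G e = {p, q}" "p \<noteq> q" "p \<in> B" "q \<notin> B"
        using edge_ends[OF ee] by metis
      then have "ends G e \<inter> - B = {q}" by auto
      then show ?thesis by simp
    qed
    then show ?thesis using False by (intro exI[of _ "- B"]) (auto simp: bipartition_def)
  qed (use bip in blast)
  then obtain B' where B': "bipartition G B'" "b \<in> B'" by blast
  interpret B': lowest_vertex G T B' b
    using fin B' T b ex low by unfold_locales auto
  have "card (contr ` ends G e \<inter> (B' - {b})) = 1" if e: "e \<in> edges G" "e \<notin> star" for e
  proof -
    obtain p q where pq: "ends G e = {p, q}" "p \<noteq> q" "p \<in> B'" "q \<notin> B'"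
      using B'.edge_ends[OF e(1)] by metis
    have "p \<notin> nbhd G {b}" "p \<noteq> b" using B'.nbhd_color pq B' e by (auto simp: star_def)
    then have "contr ` ends G e \<inter> (B' - {b}) = {p}" using pq by (auto simp: contr_def)
    then show ?thesis by simp
  qed
  then have "bipartition contracted (B' - {b})"
    by (auto simp: bipartition_def contracted_def image_graph_def)
  then show ?thesis by blast
qed

lemma push_contr:
  assumes "v \<noteq> b" "v \<notin> nbhd G {b}"
  shows "v \<in> push contr S \<longleftrightarrow> v \<in> S"
  by (rule push_fibre) (use assms in \<open>auto simp: contr_def\<close>)

lemma odd_verts_contracted:
  assumes "M \<subseteq> edges G"
  shows "odd_verts contracted (M - star) = push contr (odd_verts G M)"
proof -
  have "{e \<in> M. inj_on contr (ends G e)} = M - star" using assms inj_on_contr by auto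
  then show ?thesis
    using odd_verts_image_graph[OF fin assms, of contr "edges G - star"] by (simp add: contracted_def)
qed

text \<open>
  A circuit of the contracted graph through \<open>b\<close> lifts to a circuit of \<open>G\<close> by adding two edges at \<open>b\<close>.
  It could only lose if the lifted circuit had weight 0 and both new edges were outside \<open>M\<close>, but then
  switching along it would give a minimum join with two edges at \<open>b\<close>.
\<close>

lemma weight_nonneg_contracted:
  assumes v: "v \<in> verts G" and M: "minimum_join G (sym_diff T {v}) M"
    and Z: "Z \<subseteq> edges G - star" "odd_verts contracted Z = {}"
  shows "weight M Z \<ge> 0"
proof -
  have M': "M \<subseteq> edges G" "finite M"
    using M finite_edge_set[OF fin] by (auto simp: minimum_join_def is_join_def)
  have fE: "finite (edges G)" using fin by (simp add: finite_mgraph_def)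
  have M1: "card {e \<in> M. b \<in> ends G e} \<le> 1"
  proof (cases "v = b")
    case True
    then have "{e \<in> M. b \<in> ends G e} = {}" using no_edge_at_lowest M by auto
    then show ?thesis by (metis card.empty zero_le)
  next
    case False
    then show ?thesis using one_edge_at_lowest[OF v False M] by simp
  qed
  have M1': "e = e'" if "e \<in> M" "e' \<in> M" "b \<in> ends G e" "b \<in> ends G e'" for e e'
  proof -
    have "finite {e \<in> M. b \<in> ends G e}" using M' by simp
    then show ?thesis using M1 that
      by (metis (mono_tags, lifting) One_nat_def card_le_Suc0_iff_eq mem_Collect_eq)
  qed
  have "Z - star = Z" using Z by auto
  then have push: "push contr (odd_verts G Z) = {}"
    using odd_verts_contracted[of Z] Z by auto
  have "u = b \<or> u \<in> nbhd G {b}" if "u \<in> odd_verts G Z" for u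
    using push_contr[of u "odd_verts G Z"] that push by blast
  moreover have "b \<notin> odd_verts G Z"
  proof -
    have "{e \<in> Z. b \<in> ends G e} = {}" using Z by (auto simp: star_def)
    then show ?thesis unfolding odd_verts_def
      by (metis (mono_tags, lifting) card.empty even_zero mem_Collect_eq)
  qed
  ultimately have "odd_verts G Z \<subseteq> nbhd G {b}" by blast
  moreover have "finite Z" using Z fE by (meson Diff_subset finite_subset)
  ultimately have "finite Z" "odd_verts G Z \<subseteq> nbhd G {b}" by blast+
  then show ?thesis using Z(1)
  proof (induction Z rule: finite_psubset_induct)
    case (psubset Z)
    have ZE: "Z \<subseteq> edges G" using psubset.prems by auto
    show ?case
    proof (cases "odd_verts G Z = {}")
      case True
      then show ?thesis using weight_even_nonneg[OF fin T_diff[OF v] M ZE] by simp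
    next
      case False
      then obtain n1 where n1: "n1 \<in> odd_verts G Z" by blast
      obtain P n2 where P: "P \<subseteq> Z" "n2 \<noteq> n1" "n2 \<in> odd_verts G Z" "odd_verts G P = {n1, n2}"
        using odd_verts_pair[OF fin ZE n1] by blast
      have fP: "finite P" "finite Z" using finite_subset[OF P(1) psubset.hyps] psubset.hyps by blast+
      have "n1 \<in> nbhd G {b}" "n2 \<in> nbhd G {b}" using n1 P(3) psubset.prems by blast+
      then obtain e1 e2 where e: "e1 \<in> edges G" "ends G e1 = {b, n1}" "e2 \<in> edges G" "ends G e2 = {b, n2}"
        using nbhd_b[of n1] nbhd_b[of n2] by blast
      have nb: "n1 \<noteq> b" "n2 \<noteq> b" using \<open>n1 \<in> nbhd G {b}\<close> \<open>n2 \<in> nbhd G {b}\<close> by (auto simp: nbhd_def)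
      have ne: "e1 \<noteq> e2"
      proof
        assume "e1 = e2"
        then have "{b, n1} = {b, n2}" using e(2,4) by simp
        then show False using P(2) by (simp add: doubleton_eq_iff)
      qed
      have nP: "e1 \<notin> P" "e2 \<notin> P" using P psubset.prems e by (auto simp: star_def)
      define Q where "Q = insert e1 (insert e2 P)"
      have "odd_verts G (insert e2 P) = {b, n1}"
        using odd_verts_insert[of P e2 G] fP nP P e nb by auto
      then have Q0: "odd_verts G Q = {}"
        using odd_verts_insert[of "insert e2 P" e1 G] fP nP ne e unfolding Q_def by auto
      have QE: "Q \<subseteq> edges G" unfolding Q_def using e P ZE by auto
      have wQ: "weight M Q = weight M P + (if e2 \<in> M then -1 else 1) + (if e1 \<in> M then -1 else 1)"
        unfolding Q_def using weight_insert[of P e2 M] weight_insert[of "insert e2 P" e1 M] fP nP ne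
        by simp
      have Qnn: "weight M Q \<ge> 0" using weight_even_nonneg[OF fin T_diff[OF v] M QE Q0] .
      have "weight M P \<ge> 0"
      proof (cases "e1 \<in> M \<or> e2 \<in> M")
        case True
        then have "\<not> (e1 \<in> M \<and> e2 \<in> M)" using M1'[of e1 e2] e ne by auto
        then show ?thesis using wQ Qnn True by auto
      next
        case False
        have "weight M Q \<noteq> 0"
        proof
          assume "weight M Q = 0"
          then have m: "minimum_join G (sym_diff T {v}) (sym_diff M Q)"
            using minimum_join_switch[OF fin T_diff[OF v] M QE Q0] by simp
          have s: "{e1, e2} \<subseteq> {e \<in> sym_diff M Q. b \<in> ends G e}"
            using False e unfolding Q_def by auto
          have "finite (sym_diff M Q)" using M' fP by (auto simp: Q_def)
          then have "finite {e \<in> sym_diff M Q. b \<in> ends G e}"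
            by (rule finite_subset[rotated]) blast
          then have "card {e \<in> sym_diff M Q. b \<in> ends G e} \<ge> 2"
            using card_mono[OF _ s] ne by (metis card_2_iff)
          moreover have "v \<noteq> b" using no_edge_at_lowest m s by blast
          ultimately show False using one_edge_at_lowest[OF v _ m] by simp
        qed
        moreover have "even (weight M Q)"
          using even_weight[of Q M] even_card_bipartition[OF fin QE bip] Q0 fP by (simp add: Q_def)
        ultimately have "weight M Q \<ge> 2" using Qnn by presburger
        then show ?thesis using wQ False by simp
      qed
      moreover have "weight M (Z - P) \<ge> 0"
      proof (rule psubset.IH)
        have "P \<noteq> {}" using P(4) odd_verts_empty by auto
        then show "Z - P \<subset> Z" using P(1) by blast
        show "Z - P \<subseteq> edges G - star" using psubset.prems by auto
        show "odd_verts G (Z - P) \<subseteq> nbhd G {b}"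
          using odd_verts_Diff[of Z P G] fP P n1 psubset.prems by auto
      qed
      ultimately show ?thesis using weight_Diff[of Z P M] fP P by simp
    qed
  qed
qed

lemma minimum_join_contracted:
  assumes v: "v \<in> verts G" and M: "minimum_join G (sym_diff T {v}) M"
  shows "minimum_join contracted (sym_diff (push contr T) {contr v}) (M - star)"
    and "card M = card (M - star) + (if v = b then 0 else 1)"
proof -
  have M': "M \<subseteq> edges G" "odd_verts G M = sym_diff T {v}" "finite M"
    using M is_join_T_diff[OF v] finite_edge_set[OF fin] by (auto simp: minimum_join_def)
  have fT: "finite T" using T fin by (auto simp: finite_mgraph_def intro: finite_subset)
  have od: "odd_verts contracted (M - star) = sym_diff (push contr T) {contr v}"
    using odd_verts_contracted[OF M'(1)] M' push_sym_diff[of T "{v}" contr] fT by simp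
  have Ec: "edges contracted = edges G - star" by (simp add: contracted_def image_graph_def)
  have sub: "M - star \<subseteq> edges contracted" using M' Ec by auto
  have Ts: "sym_diff (push contr T) {contr v} \<subseteq> verts contracted"
    using odd_verts_subset[OF finite_contracted sub] od by simp
  show "minimum_join contracted (sym_diff (push contr T) {contr v}) (M - star)"
  proof (rule minimum_joinI_weight[OF finite_contracted Ts])
    show "is_join contracted (sym_diff (push contr T) {contr v}) (M - star)"
      using is_join_iff[OF finite_contracted Ts] sub od by simp
    fix Z assume Z: "Z \<subseteq> edges contracted" "odd_verts contracted Z = {}"
    then have "Z - (M - star) = Z - M" "Z \<inter> (M - star) = Z \<inter> M" using Ec by auto
    then have "weight (M - star) Z = weight M Z" by (simp add: weight_def)
    then show "weight (M - star) Z \<ge> 0" using weight_nonneg_contracted[OF v M] Z Ec by simp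
  qed
  have "M \<inter> star = {e \<in> M. b \<in> ends G e}" using M' by (auto simp: star_def)
  moreover have "{e \<in> M. b \<in> ends G e} = {}" if "v = b"
    using no_edge_at_lowest M that by blast
  ultimately have "card (M \<inter> star) = (if v = b then 0 else 1)"
    using one_edge_at_lowest[OF v _ M] by (metis card.empty)
  then show "card M = card (M - star) + (if v = b then 0 else 1)"
    using M' card_Diff_subset_Int[of M star] card_mono[of M "M \<inter> star"] by auto
qed

lemma join_number_contracted:
  assumes v: "v \<in> verts G"
  shows "join_number G (sym_diff T {v}) =
    join_number contracted (sym_diff (push contr T) {contr v}) + (if v = b then 0 else 1)"
proof -
  obtain F where "is_join G (sym_diff T {v}) F" using ex[OF v] by blast
  then obtain M where "minimum_join G (sym_diff T {v}) M" by (rule obtains_minimum_join)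
  then show ?thesis
    using minimum_join_contracted[OF v] minimum_join_iff by metis
qed

end

section \<open>Edges at the highest vertex\<close>

definition cut_connected :: "('v, 'e) mgraph \<Rightarrow> 'v set \<Rightarrow> bool" where
  "cut_connected G U \<longleftrightarrow> (\<forall>Y. Y \<subseteq> U \<longrightarrow> Y \<noteq> {} \<longrightarrow> Y \<noteq> U \<longrightarrow>
     (\<exists>e\<in>edges G. ends G e \<inter> Y \<noteq> {} \<and> ends G e \<inter> (U - Y) \<noteq> {}))"

lemma join_number_adjacent:
  assumes G: "finite_mgraph G" and B: "bipartition G B" and T: "T \<subseteq> verts G"
    and ex: "\<exists>M. is_join G (sym_diff T {u}) M"
    and e: "e \<in> edges G" "ends G e = {u, v}" "u \<noteq> v"
  shows "join_number G (sym_diff T {u}) \<noteq> join_number G (sym_diff T {v})"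
proof -
  have uv: "u \<in> verts G" "v \<in> verts G" using e G by (auto simp: finite_mgraph_def)
  obtain M where M: "minimum_join G (sym_diff T {u}) M" using ex obtains_minimum_join by blast
  have j: "is_join G (sym_diff T {u}) M" using M by (simp add: minimum_join_def)
  have "sym_diff T {u} \<subseteq> verts G" "sym_diff T {v} \<subseteq> verts G" using T uv by auto
  note ij = is_join_iff[OF G this(1)] is_join_iff[OF G this(2)]
  have "sym_diff (sym_diff T {u}) {u, v} = sym_diff T {v}" using e by auto
  then have "is_join G (sym_diff T {v}) (sym_diff M {e})"
    using is_join_switch[OF G _ j, of "{e}"] e uv T by auto
  then obtain N where N: "minimum_join G (sym_diff T {v}) N" using obtains_minimum_join by blast
  have M': "M \<subseteq> edges G" "odd_verts G M = sym_diff T {u}"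
    and N': "N \<subseteq> edges G" "odd_verts G N = sym_diff T {v}"
    using M N ij by (auto simp: minimum_join_def)
  have "card (ends G e \<inter> B) = 1" using B e(1) by (simp add: bipartition_def)
  then have "{u, v} \<inter> B = {u} \<or> {u, v} \<inter> B = {v}" using e by (auto simp: card_1_singleton_iff)
  then have c: "(u \<in> B) \<noteq> (v \<in> B)" using e by auto
  have fT: "finite (T \<inter> B)" using T G by (meson finite_mgraph_def finite_Int finite_subset)
  have *: "odd (card (sym_diff T {w} \<inter> B)) \<longleftrightarrow> odd (card (T \<inter> B)) \<noteq> (w \<in> B)" for w
  proof -
    have "sym_diff T {w} \<inter> B = sym_diff (T \<inter> B) ({w} \<inter> B)" by auto
    then have "odd (card (sym_diff T {w} \<inter> B)) \<longleftrightarrow> odd (card (T \<inter> B)) \<noteq> odd (card ({w} \<inter> B))"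
      using odd_card_sym_diff[of "T \<inter> B" "{w} \<inter> B"] fT by simp
    moreover have "odd (card ({w} \<inter> B)) \<longleftrightarrow> w \<in> B" by (cases "w \<in> B") auto
    ultimately show ?thesis by simp
  qed
  have "even (card M) \<longleftrightarrow> even (card (sym_diff T {u} \<inter> B))"
    using even_card_bipartition[OF G M'(1) B] M'(2) by simp
  moreover have "even (card N) \<longleftrightarrow> even (card (sym_diff T {v} \<inter> B))"
    using even_card_bipartition[OF G N'(1) B] N'(2) by simp
  ultimately have "even (card M) \<noteq> even (card N)" using *[of u] *[of v] c by blast
  then show ?thesis using M N minimum_join_iff by metis
qed

theorem edges_at_highest_vertex:
  assumes "finite_mgraph G" "bipartition G B" "T \<subseteq> verts G" "x \<in> verts G"
    and "\<And>v. v \<in> verts G \<Longrightarrow> \<exists>M. is_join G (sym_diff T {v}) M"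
    and "\<And>v. v \<in> verts G - {x} \<Longrightarrow> join_number G (sym_diff T {v}) < join_number G (sym_diff T {x})"
    and "cut_connected G (verts G - {x})" "verts G - {x} \<noteq> {}"
    and "v \<in> verts G" "minimum_join G (sym_diff T {v}) M"
  shows "card {e \<in> M. x \<in> ends G e} = (if v = x then 1 else 0)"
proof -
  have "finite (verts G)" using assms(1) by (simp add: finite_mgraph_def)
  then show ?thesis using assms
  proof (induction "card (verts G)" arbitrary: G B T v M rule: less_induct)
    case less
    note hyps = less.prems
    let ?g = "\<lambda>v. join_number G (sym_diff T {v})"
    define b where "b = arg_min_on ?g (verts G - {x})"
    have fV: "finite (verts G - {x})" using hyps by simp
    have bx: "b \<in> verts G" "b \<noteq> x" "\<And>w. w \<in> verts G - {x} \<Longrightarrow> ?g b \<le> ?g w"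
      using arg_min_if_finite[OF fV hyps(9), of ?g] arg_min_least[OF fV hyps(9), of _ ?g]
      unfolding b_def by auto
    have low: "?g b \<le> ?g w" if "w \<in> verts G" for w
      using that bx hyps(7)[of b] by (cases "w = x") auto
    interpret lowest_vertex G T B b
      using hyps bx low by unfold_locales auto
    have fM: "finite M" "M \<subseteq> edges G"
      using hyps(11) finite_edge_set[OF hyps(2)] by (auto simp: minimum_join_def is_join_def)
    show ?case
    proof (cases "verts G = {x, b}")
      case True
      have "ends G e = {x, b}" if "e \<in> edges G" for e
        using edge_ends[OF that] True by (metis doubleton_eq_iff insertE singletonD)
      then have eq: "{e \<in> M. x \<in> ends G e} = {e \<in> M. b \<in> ends G e}" using fM by auto
      show ?thesis
      proof (cases "v = x")
        case True
        then have "card {e \<in> M. b \<in> ends G e} = 1"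
          using one_edge_at_lowest[OF hyps(10) _ hyps(11)] bx(2) by blast
        then show ?thesis using True eq by simp
      next
        case False
        then have "v = b" using True hyps(10) by blast
        then have "{e \<in> M. b \<in> ends G e} = {}" using no_edge_at_lowest hyps(11) by blast
        then show ?thesis unfolding eq using False by (simp only: card.empty if_False)
      qed
    next
      case False
      then have "{b} \<noteq> verts G - {x}" using hyps(5) bx(1,2) by blast
      then obtain e where e: "e \<in> edges G" "ends G e \<inter> {b} \<noteq> {}" "ends G e \<inter> (verts G - {x} - {b}) \<noteq> {}"
      proof -
        have "{b} \<subseteq> verts G - {x}" "{b} \<noteq> {}" using bx(1,2) by auto
        with \<open>{b} \<noteq> verts G - {x}\<close> show ?thesis
          using hyps(8) that unfolding cut_connected_def by blast
      qed
      then obtain c where "c \<in> ends G e" "c \<in> verts G" "c \<noteq> x" "c \<noteq> b" by blast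
      moreover from this have "ends G e = {b, c}"
        using ends_eq_doubleton[OF hyps(2) e(1), of b c] e(2) by blast
      ultimately have c: "ends G e = {b, c}" "c \<noteq> b" "c \<noteq> x" "c \<in> verts G" by auto
      have "?g b \<noteq> ?g c"
        using join_number_adjacent[OF hyps(2,3,4) _ e(1) c(1)] hyps(6)[OF bx(1)] c by auto
      then have "?g b < ?g c" using bx(3) c by (simp add: le_neq_implies_less)
      then have gb: "?g b + 2 \<le> ?g x" using hyps(7)[of c] c by auto
      have xn: "x \<notin> nbhd G {b}"
      proof
        assume "x \<in> nbhd G {b}"
        then obtain e' where e': "e' \<in> edges G" "ends G e' = {b, x}" using nbhd_b by blast
        obtain N where N: "minimum_join G (sym_diff T {b}) N"
          using obtains_minimum_join hyps(6)[OF bx(1)] by metis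
        have "sym_diff (sym_diff T {b}) {b, x} = sym_diff T {x}" using bx(2) by auto
        then have "is_join G (sym_diff T {x}) (sym_diff N {e'})"
          using is_join_switch[OF hyps(2) T_diff[OF bx(1)], of N "{e'}"] N e'
          by (auto simp: minimum_join_def)
        then have "?g x \<le> card (sym_diff N {e'})" by (rule join_number_le)
        also have "\<dots> \<le> card N + 1"
        proof -
          have "finite N" using N finite_edge_set[OF hyps(2)] by (auto simp: minimum_join_def is_join_def)
          then have "card (sym_diff N {e'}) \<le> card (insert e' N)" by (intro card_mono) auto
          also have "\<dots> \<le> card N + 1" using card_insert_le_m1[of "Suc (card N)" N e'] by simp
          finally show ?thesis .
        qed
        finally show False using gb N minimum_join_iff[of G "sym_diff T {b}" N] by auto
      qed
      have cx: "contr x = x" using xn by (simp add: contr_def)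
      have cn: "c \<in> nbhd G {b}" using nbhd_b e c by blast
      have vc: "verts contracted = contr ` verts G" by (simp add: contracted_def image_graph_def)
      have bn: "b \<notin> nbhd G {b}" by (simp add: nbhd_def)
      have vc': "verts contracted = verts G - nbhd G {b}"
        unfolding vc using bx(1) bn by (auto simp: contr_def)
      have cxi: "contr w = x \<longleftrightarrow> w = x" for w using xn bx(2) by (auto simp: contr_def)
      have Ec: "edges contracted = edges G - star" "\<And>e. ends contracted e = contr ` ends G e"
        by (simp_all add: contracted_def image_graph_def)
      obtain B' where B': "bipartition contracted B'" using bipartition_contracted by blast
      have IH: "card {e \<in> M - star. x \<in> ends contracted e} = (if contr v = x then 1 else 0)"
      proof (rule less.hyps[where T = "push contr T" and B = B'])
        show "card (verts contracted) < card (verts G)"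
          unfolding vc' using c(4) cn hyps(1) by (intro psubset_card_mono) blast+
        show "finite (verts contracted)" unfolding vc' using hyps(1) by simp
        show "finite_mgraph contracted" by (rule finite_contracted)
        show "bipartition contracted B'" by (rule B')
        show "push contr T \<subseteq> verts contracted" using push_subset[of contr T] image_mono[OF T, of contr] unfolding vc by (rule subset_trans)
        show "x \<in> verts contracted" unfolding vc' using xn hyps(5) by simp
        show "\<exists>M. is_join contracted (sym_diff (push contr T) {w}) M" if w: "w \<in> verts contracted" for w
        proof -
          obtain u where u: "u \<in> verts G" "w = contr u" using w vc by auto
          obtain N where "minimum_join G (sym_diff T {u}) N"
            using obtains_minimum_join hyps(6)[OF u(1)] by metis
          then show ?thesis using minimum_join_contracted(1)[OF u(1)] u by (auto simp: minimum_join_def)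
        qed
        show "join_number contracted (sym_diff (push contr T) {w}) < join_number contracted (sym_diff (push contr T) {x})"
          if w: "w \<in> verts contracted - {x}" for w
        proof -
          have 1: "w \<in> verts G" "w \<noteq> x" "contr w = w" using w vc' by (auto simp: contr_def)
          show ?thesis
            using join_number_contracted[OF 1(1)] join_number_contracted[OF hyps(5)] cx 1 gb
              hyps(7)[of w] bx(2) by (cases "w = b") auto
        qed
        show "cut_connected contracted (verts contracted - {x})"
          unfolding cut_connected_def
        proof (intro allI impI)
          fix Y assume Y: "Y \<subseteq> verts contracted - {x}" "Y \<noteq> {}" "Y \<noteq> verts contracted - {x}"
          define Y' where "Y' = {u \<in> verts G - {x}. contr u \<in> Y}"
          have "contr u = u" if "u \<in> verts contracted" for u using that vc' by (auto simp: contr_def)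
          then have "Y \<subseteq> Y'" "verts contracted - {x} - Y \<subseteq> verts G - {x} - Y'"
            unfolding Y'_def using Y vc' by auto
          then have "Y' \<subseteq> verts G - {x}" "Y' \<noteq> {}" "Y' \<noteq> verts G - {x}"
            using Y unfolding Y'_def by blast+
          then obtain e' where e': "e' \<in> edges G" "ends G e' \<inter> Y' \<noteq> {}" "ends G e' \<inter> (verts G - {x} - Y') \<noteq> {}"
            using hyps(8) unfolding cut_connected_def by blast
          then obtain p q where pq: "p \<in> ends G e'" "q \<in> ends G e'" "p \<in> Y'" "q \<in> verts G - {x} - Y'" by blast
          have "contr p \<in> Y" "contr q \<in> verts contracted - {x} - Y"
            using pq vc cxi unfolding Y'_def by auto
          moreover have "e' \<notin> star"
          proof
            assume "e' \<in> star"
            then have "\<not> inj_on contr (ends G e')" using inj_on_contr e' by blast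
            moreover have "ends G e' = {p, q}" using ends_eq_doubleton[OF hyps(2) e'(1), of p q] pq by blast
            ultimately have "contr p = contr q" by auto
            then show False using \<open>contr p \<in> Y\<close> \<open>contr q \<in> verts contracted - {x} - Y\<close> by simp
          qed
          ultimately show "\<exists>e\<in>edges contracted. ends contracted e \<inter> Y \<noteq> {} \<and>
              ends contracted e \<inter> (verts contracted - {x} - Y) \<noteq> {}"
            using Ec e' pq by (intro bexI[of _ e']) auto
        qed
        show "verts contracted - {x} \<noteq> {}"
          using bx(1,2) bn vc' by auto
        show "contr v \<in> verts contracted" using vc hyps(10) by simp
        show "minimum_join contracted (sym_diff (push contr T) {contr v}) (M - star)"
          by (rule minimum_join_contracted(1)[OF hyps(10,11)])
      qed
      have "{e \<in> M - star. x \<in> ends contracted e} = {e \<in> M. x \<in> ends G e}"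
      proof -
        have "x \<notin> ends G e" if "e \<in> star" for e
        proof
          assume "x \<in> ends G e"
          then have "ends G e = {b, x}"
            using that bx(2) ends_eq_doubleton[OF hyps(2), of e b x] by (auto simp: star_def)
          then show False using xn nbhd_b that by (auto simp: star_def)
        qed
        moreover have "x \<in> contr ` ends G e \<longleftrightarrow> x \<in> ends G e" for e using cxi by (metis imageE imageI)
        ultimately show ?thesis using Ec by auto
      qed
      then show ?thesis using IH cxi by simp
    qed
  qed
qed

section \<open>Paths, distances and components\<close>

lemma path_between_singleton: "x \<in> verts G \<Longrightarrow> path_between G x x [x] []"
  by (simp add: path_between_def)

lemma path_between_Cons:
  assumes "path_between G u y vs es" "e \<in> edges G" "ends G e = {x, u}" "x \<in> verts G" "x \<notin> set vs"
  shows "path_between G x y (x # vs) (e # es)"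
proof -
  have "ends G ((e # es) ! i) = {(x # vs) ! i, (x # vs) ! Suc i}" if "i < length (e # es)" for i
    using assms that by (cases i) (auto simp: path_between_def hd_conv_nth)
  then show ?thesis using assms by (auto simp: path_between_def)
qed

lemma path_between_ConsE:
  assumes "path_between G x y vs (e # es)"
  obtains u vs' where "vs = x # vs'" "path_between G u y vs' es" "e \<in> edges G" "ends G e = {x, u}"
    "x \<in> verts G" "x \<notin> set vs'"
proof -
  obtain vs' where vs: "vs = x # vs'" using assms by (cases vs) (auto simp: path_between_def)
  then have ne: "vs' \<noteq> []" using assms by (auto simp: path_between_def)
  have "ends G e = {x, hd vs'}"
  proof -
    have "ends G ((e # es) ! 0) = {vs ! 0, vs ! Suc 0}"
      using assms unfolding path_between_def by blast
    then show ?thesis using vs ne by (simp add: hd_conv_nth)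
  qed
  moreover have "path_between G (hd vs') y vs' es"
  proof -
    have "ends G (es ! i) = {vs' ! i, vs' ! Suc i}" if "i < length es" for i
    proof -
      have "ends G ((e # es) ! Suc i) = {vs ! Suc i, vs ! Suc (Suc i)}"
        using assms that unfolding path_between_def by (metis Suc_less_eq length_Cons)
      then show ?thesis using vs by simp
    qed
    then show ?thesis using assms vs ne by (auto simp: path_between_def)
  qed
  ultimately show ?thesis using that vs assms by (auto simp: path_between_def)
qed

lemma path_between_suffix:
  assumes "path_between G x y vs es" "z \<in> set vs"
  obtains vs' es' where "path_between G z y vs' es'" "set es' \<subseteq> set es"
proof -
  have "\<exists>vs' es'. path_between G z y vs' es' \<and> set es' \<subseteq> set es"
    using assms
  proof (induction es arbitrary: x vs)
    case Nil
    then have "vs = [x]" by (cases vs) (auto simp: path_between_def)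
    then show ?case using Nil by auto
  next
    case (Cons e es)
    obtain u vs' where u: "vs = x # vs'" "path_between G u y vs' es"
      using path_between_ConsE[OF Cons.prems(1)] by metis
    show ?case
    proof (cases "z = x")
      case True
      then show ?thesis using Cons.prems(1) by blast
    next
      case False
      then have "z \<in> set vs'" using Cons.prems(2) u(1) by simp
      then obtain vs2 es2 where "path_between G z y vs2 es2" "set es2 \<subseteq> set es"
        using Cons.IH[OF u(2)] by blast
      then show ?thesis by (intro exI[of _ vs2] exI[of _ es2]) auto
    qed
  qed
  then show ?thesis using that by blast
qed

lemma ends_subset_path:
  assumes "path_between G x y vs es" "e \<in> set es"
  shows "ends G e \<subseteq> set vs"
proof -
  obtain i where "i < length es" "e = es ! i" using assms by (metis in_set_conv_nth)
  then show ?thesis using assms by (auto simp: path_between_def)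
qed

lemma odd_verts_path:
  assumes "path_between G x y vs es"
  shows "odd_verts G (set es) = sym_diff {x} {y}"
  using assms
proof (induction es arbitrary: x vs)
  case Nil
  then have "vs = [x]" by (cases vs) (auto simp: path_between_def)
  then show ?case using Nil by (auto simp: path_between_def)
next
  case (Cons e es)
  obtain u vs' where u: "vs = x # vs'" "path_between G u y vs' es" "ends G e = {x, u}" "x \<notin> set vs'"
    using path_between_ConsE[OF Cons.prems(1)] by metis
  have "e \<notin> set es" using ends_subset_path[OF u(2)] u(3,4) by auto
  then have "odd_verts G (set (e # es)) = sym_diff (sym_diff {u} {y}) {x, u}"
    using odd_verts_insert[of "set es" e G] Cons.IH[OF u(2)] u(3) by simp
  moreover have "u \<noteq> x" "y \<noteq> x"
  proof -
    have "u \<in> set vs'" "y \<in> set vs'" using u(2) by (auto simp: path_between_def)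
    then show "u \<noteq> x" "y \<noteq> x" using u(4) by auto
  qed
  ultimately show ?case by auto
qed

lemma odd_verts_contains_path:
  assumes "finite_mgraph G" "J \<subseteq> edges G" "x \<in> odd_verts G J"
  obtains vs es y where "path_between G x y vs es" "set es \<subseteq> J" "y \<noteq> x" "y \<in> odd_verts G J"
proof -
  have "finite J" using assms finite_edge_set by blast
  then have "\<exists>vs es y. path_between G x y vs es \<and> set es \<subseteq> J \<and> y \<noteq> x \<and> y \<in> odd_verts G J"
    using assms(2,3)
  proof (induction J arbitrary: x rule: finite_psubset_induct)
    case (psubset J)
    have "{e \<in> J. x \<in> ends G e} \<noteq> {}"
      using psubset.prems(2) unfolding odd_verts_def
      by (metis (mono_tags, lifting) card.empty even_zero mem_Collect_eq)
    then obtain e where e: "e \<in> J" "x \<in> ends G e" by blast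
    then have eE: "e \<in> edges G" using psubset.prems(1) by blast
    obtain x' where x': "ends G e = {x, x'}" "x \<noteq> x'" "x' \<in> verts G"
      using ends_other[OF assms(1) eE e(2)] by metis
    have xV: "x \<in> verts G" using eE e(2) assms(1) by (auto simp: finite_mgraph_def)
    show ?case
    proof (cases "x' \<in> odd_verts G J")
      case True
      have "path_between G x x' [x, x'] [e]"
        using path_between_Cons[OF path_between_singleton[OF x'(3)] eE x'(1) xV] x'(2) by simp
      then show ?thesis using e(1) x'(2) True
        by (intro exI[of _ "[x, x']"] exI[of _ "[e]"] exI[of _ x']) auto
    next
      case False
      have od: "odd_verts G (J - {e}) = sym_diff (odd_verts G J) {x, x'}"
        using odd_verts_Diff[of J "{e}" G] psubset.hyps e(1) x'(1) by simp
      then have "x' \<in> odd_verts G (J - {e})" using False by simp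
      moreover have "J - {e} \<subset> J" "J - {e} \<subseteq> edges G" using e(1) psubset.prems(1) by auto
      ultimately obtain vs es y where p: "path_between G x' y vs es" "set es \<subseteq> J - {e}" "y \<noteq> x'"
          "y \<in> odd_verts G (J - {e})"
        using psubset.IH by metis
      have y: "y \<noteq> x" "y \<in> odd_verts G J" using p(3,4) od psubset.prems(2) by auto
      show ?thesis
      proof (cases "x \<in> set vs")
        case True
        then obtain vs' es' where "path_between G x y vs' es'" "set es' \<subseteq> set es"
          using path_between_suffix[OF p(1)] by metis
        then show ?thesis using p(2) y by (intro exI[of _ vs'] exI[of _ es'] exI[of _ y]) auto
      next
        case False
        then have "path_between G x y (x # vs) (e # es)"
          using path_between_Cons[OF p(1) eE x'(1) xV] by simp
        then show ?thesis using p(2) y e(1)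
          by (intro exI[of _ "x # vs"] exI[of _ "e # es"] exI[of _ y]) auto
      qed
    qed
  qed
  then show ?thesis using that by blast
qed

definition conservative :: "('v, 'e) mgraph \<Rightarrow> 'e set \<Rightarrow> bool" where
  "conservative G F \<longleftrightarrow> (\<forall>Z\<subseteq>edges G. odd_verts G Z = {} \<longrightarrow> weight F Z \<ge> 0)"

lemma join_dist_le:
  assumes G: "finite_mgraph G" and F: "conservative G F"
    and J: "J \<subseteq> edges G" "odd_verts G J = {x, y}" and xy: "x \<noteq> y"
  shows "join_dist G F x y \<le> ereal (of_int (weight F J))"
proof -
  have "x \<in> odd_verts G J" using J(2) by simp
  then obtain vs es y' where p: "path_between G x y' vs es" "set es \<subseteq> J" "y' \<noteq> x" "y' \<in> odd_verts G J"
    using odd_verts_contains_path[OF G J(1)] by metis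
  have y': "y' = y" using p(3,4) J(2) by blast
  have fJ: "finite J" using J G finite_edge_set by blast
  have "sym_diff {x, y} (sym_diff {x} {y}) = {}" using xy by auto
  then have "odd_verts G (J - set es) = {}"
    using odd_verts_Diff[OF fJ p(2), of G] odd_verts_path[OF p(1)] J(2) y' by simp
  moreover have "J - set es \<subseteq> edges G" using J(1) by blast
  ultimately have "weight F (J - set es) \<ge> 0" using F unfolding conservative_def by metis
  then have "weight F (set es) \<le> weight F J" using weight_Diff[OF fJ p(2), of F] by simp
  then have "ereal (of_int (weight F (set es))) \<le> ereal (of_int (weight F J))" by simp
  moreover have "join_dist G F x y \<le> ereal (of_int (weight F (set es)))"
    unfolding join_dist_def using xy p(1) y' by (auto intro!: Inf_lower)
  ultimately show ?thesis by (rule order_trans[rotated])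
qed

lemma join_dist_ge:
  assumes "x \<noteq> y"
    and "\<And>J. J \<subseteq> edges G \<Longrightarrow> odd_verts G J = {x, y} \<Longrightarrow> k \<le> weight F J"
  shows "ereal (of_int k) \<le> join_dist G F x y"
proof -
  have "k \<le> weight F (set es)" if "path_between G x y vs es" for vs es
  proof (rule assms(2))
    show "set es \<subseteq> edges G" using that by (simp add: path_between_def)
    show "odd_verts G (set es) = {x, y}" using odd_verts_path[OF that] assms(1) by auto
  qed
  then show ?thesis unfolding join_dist_def using assms(1) by (auto intro!: Inf_greatest)
qed

lemma join_dist_less_zero_iff:
  assumes "finite_mgraph G" "conservative G F" "x \<noteq> y"
  shows "join_dist G F x y < 0 \<longleftrightarrow> (\<exists>J\<subseteq>edges G. odd_verts G J = {x, y} \<and> weight F J < 0)"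
proof
  assume "join_dist G F x y < 0"
  then have "\<not> ereal (of_int 0) \<le> join_dist G F x y" by (simp add: zero_ereal_def)
  then show "\<exists>J\<subseteq>edges G. odd_verts G J = {x, y} \<and> weight F J < 0"
    using join_dist_ge[OF assms(3), of G 0 F] by (metis not_less)
next
  assume "\<exists>J\<subseteq>edges G. odd_verts G J = {x, y} \<and> weight F J < 0"
  then obtain J where J: "J \<subseteq> edges G" "odd_verts G J = {x, y}" "weight F J < 0" by blast
  have "join_dist G F x y \<le> ereal (of_int (weight F J))"
    using join_dist_le[OF assms(1,2) J(1,2) assms(3)] .
  also have "\<dots> < 0" using J(3) by (simp add: zero_ereal_def)
  finally show "join_dist G F x y < 0" .
qed

definition adj :: "('v, 'e) mgraph \<Rightarrow> ('v \<times> 'v) set" where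
  "adj G = {(u, v). \<exists>e\<in>edges G. ends G e = {u, v}}"

definition reach :: "('v, 'e) mgraph \<Rightarrow> 'v \<Rightarrow> 'v set" where
  "reach G x = (adj G)\<^sup>* `` {x}"

lemma sym_adj: "sym (adj G)"
  by (auto simp: sym_def adj_def insert_commute)

lemma reach_refl: "x \<in> reach G x"
  by (simp add: reach_def)

lemma reach_eq: "y \<in> reach G x \<Longrightarrow> reach G y = reach G x"
proof -
  assume "y \<in> reach G x"
  then have "(x, y) \<in> (adj G)\<^sup>*" by (simp add: reach_def)
  moreover from this have "(y, x) \<in> (adj G)\<^sup>*"
    using sym_rtrancl[OF sym_adj, of G] by (meson symD)
  ultimately show ?thesis unfolding reach_def by (auto intro: rtrancl_trans)
qed

lemma reach_step:
  assumes "u \<in> reach G x" "e \<in> edges G" "ends G e = {u, v}"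
  shows "v \<in> reach G x"
proof -
  have "(u, v) \<in> adj G" using assms by (auto simp: adj_def)
  then show ?thesis using assms(1) by (auto simp: reach_def intro: rtrancl_into_rtrancl)
qed

lemma reach_subset:
  assumes "x \<in> S" "\<And>u v e. u \<in> S \<Longrightarrow> e \<in> edges G \<Longrightarrow> ends G e = {u, v} \<Longrightarrow> v \<in> S"
  shows "reach G x \<subseteq> S"
proof
  fix y assume "y \<in> reach G x"
  then have "(x, y) \<in> (adj G)\<^sup>*" by (simp add: reach_def)
  then show "y \<in> S"
  proof (induction rule: rtrancl_induct)
    case base
    then show ?case using assms(1) .
  next
    case (step y z)
    then obtain e where "e \<in> edges G" "ends G e = {y, z}" by (auto simp: adj_def)
    then show ?case using assms(2) step.IH by blast
  qed
qed

lemma reach_eq_paths: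
  assumes G: "finite_mgraph G" and x: "x \<in> verts G"
  shows "{y. \<exists>vs es. path_between G x y vs es} = reach G x"
proof (intro equalityI subsetI)
  fix y assume "y \<in> {y. \<exists>vs es. path_between G x y vs es}"
  then obtain vs es where "path_between G x y vs es" by blast
  then show "y \<in> reach G x"
  proof (induction es arbitrary: x vs)
    case Nil
    then have "vs = [x]" by (cases vs) (auto simp: path_between_def)
    then have "x = y" using Nil by (simp add: path_between_def)
    then show ?case by (simp add: reach_refl)
  next
    case (Cons e es)
    obtain u vs' where u: "path_between G u y vs' es" "e \<in> edges G" "ends G e = {x, u}"
      using path_between_ConsE[OF Cons.prems] by metis
    have "u \<in> reach G x" using reach_step[OF reach_refl u(2,3)] .
    then show ?case using Cons.IH[OF u(1)] reach_eq by metis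
  qed
next
  fix y assume "y \<in> reach G x"
  then have "(x, y) \<in> (adj G)\<^sup>*" by (simp add: reach_def)
  then have "x \<in> verts G \<longrightarrow> (\<exists>vs es. path_between G x y vs es)"
  proof (induction rule: converse_rtrancl_induct)
    case base
    then show ?case using path_between_singleton by metis
  next
    case (step x z)
    then obtain e where e: "e \<in> edges G" "ends G e = {x, z}" by (auto simp: adj_def)
    then have V: "x \<in> verts G" "z \<in> verts G" using G by (auto simp: finite_mgraph_def)
    then obtain vs es where p: "path_between G z y vs es" using step.IH by blast
    show ?case
    proof (cases "x \<in> set vs")
      case True
      then show ?thesis using path_between_suffix[OF p] by metis
    next
      case False
      then show ?thesis using path_between_Cons[OF p e V(1)] by metis
    qed
  qed
  then show "y \<in> {y. \<exists>vs es. path_between G x y vs es}" using x by blast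
qed

lemma components_eq_reach:
  assumes "finite_mgraph G"
  shows "components G = {induced G (reach G x) | x. x \<in> verts G}"
  unfolding components_def using reach_eq_paths[OF assms] by (metis (no_types, lifting))

lemma finite_mgraph_induced: "finite_mgraph G \<Longrightarrow> finite_mgraph (induced G Y)"
  by (auto simp: finite_mgraph_def induced_def edges_within_def)

lemma odd_verts_cong: "ends G = ends H \<Longrightarrow> odd_verts G J = odd_verts H J"
  by (simp add: odd_verts_def)

lemma ends_induced [simp]: "ends (induced G Y) = ends G"
  by (simp add: induced_def)

lemma odd_verts_induced [simp]: "odd_verts (induced G Y) J = odd_verts G J"
  by (rule odd_verts_cong) simp

lemma verts_induced: "verts (induced G Y) = verts G \<inter> Y"
  by (simp add: induced_def)

lemma edges_induced: "edges (induced G Y) = edges_within G Y"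
  by (simp add: induced_def)

section \<open>Maximal extreme sets\<close>

locale maximal_extreme_set =
  fixes G :: "('v, 'e) mgraph" and T A B X :: "'v set" and F :: "'e set"
  assumes bipartite: "bipartite_graft G T A B"
    and min: "minimum_join G T F"
    and XA: "X \<subseteq> A"
    and maximal: "maximal_bipartitic_extreme G A B F X"
begin

lemma fin: "finite_mgraph G" and TV: "T \<subseteq> verts G" and AB: "A \<union> B = verts G" "A \<inter> B = {}"
  using bipartite by (auto simp: bipartite_graft_def graft_def)

lemma edge_ends:
  assumes "e \<in> edges G"
  obtains a b where "ends G e = {a, b}" "a \<in> A" "b \<in> B"
  using bipartite assms unfolding bipartite_graft_def by metis

lemma edge_color:
  assumes "e \<in> edges G" "ends G e = {u, v}"
  shows "u \<in> A \<longleftrightarrow> v \<in> B"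
proof -
  obtain a b where "ends G e = {a, b}" "a \<in> A" "b \<in> B" using edge_ends[OF assms(1)] by metis
  then have "(u = a \<and> v = b) \<or> (u = b \<and> v = a)" "a \<in> A" "b \<in> B" "a \<notin> B" "b \<notin> A"
    using assms(2) AB by (auto simp: doubleton_eq_iff)
  then show ?thesis by blast
qed

lemma edge_distinct: "e \<in> edges G \<Longrightarrow> ends G e = {u, v} \<Longrightarrow> u \<noteq> v"
  using edge_color[of e u v] AB edge_ends[of e]
  by (metis disjoint_iff doubleton_eq_iff)

lemma bip: "bipartition G B"
proof -
  have "card (ends G e \<inter> B) = 1" if e: "e \<in> edges G" for e
  proof -
    obtain a b where "ends G e = {a, b}" "a \<in> A" "b \<in> B" using edge_ends[OF e] by metis
    then have "ends G e \<inter> B = {b}" using AB by auto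
    then show ?thesis by simp
  qed
  then show ?thesis by (simp add: bipartition_def)
qed

lemma F_edges: "F \<subseteq> edges G" and F_odd: "odd_verts G F = T" and fin_F: "finite F"
  using min is_join_iff[OF fin TV] finite_edge_set[OF fin] by (auto simp: minimum_join_def)

lemma conservative_F: "conservative G F"
  unfolding conservative_def using weight_even_nonneg[OF fin TV min] by blast

lemma XV: "X \<subseteq> verts G"
  using XA AB by auto

lemma extreme_X: "extreme G F X"
  using maximal by (simp add: maximal_bipartitic_extreme_def bipartitic_extreme_def)

lemma weight_nonneg_X:
  assumes "J \<subseteq> edges G" "odd_verts G J \<subseteq> X"
  shows "weight F J \<ge> 0"
proof -
  have "finite J" using assms(1) finite_edge_set[OF fin] by blast
  then show ?thesis using assms
  proof (induction J rule: finite_psubset_induct)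
    case (psubset J)
    show ?case
    proof (cases "odd_verts G J = {}")
      case True
      then show ?thesis using conservative_F psubset.prems by (simp add: conservative_def)
    next
      case False
      then obtain x where x: "x \<in> odd_verts G J" by blast
      obtain P y where P: "P \<subseteq> J" "y \<noteq> x" "y \<in> odd_verts G J" "odd_verts G P = {x, y}"
        using odd_verts_pair[OF fin psubset.prems(1) x] by blast
      have PE: "P \<subseteq> edges G" using P(1) psubset.prems(1) by blast
      have "join_dist G F x y \<ge> 0"
        using extreme_X x P(3) psubset.prems(2) unfolding extreme_def by blast
      then have "weight F P \<ge> 0"
        using join_dist_less_zero_iff[OF fin conservative_F P(2)[symmetric]] PE P(4)
        by (metis not_less)
      moreover have "weight F (J - P) \<ge> 0"
      proof (rule psubset.IH)
        have "P \<noteq> {}" using P(4) by auto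
        then show "J - P \<subset> J" using P(1) by blast
        show "J - P \<subseteq> edges G" using psubset.prems(1) by blast
        show "odd_verts G (J - P) \<subseteq> X"
          using odd_verts_Diff[OF psubset.hyps P(1), of G] P(3,4) x psubset.prems(2) by auto
      qed
      ultimately show ?thesis using weight_Diff[OF psubset.hyps P(1), of F] by simp
    qed
  qed
qed

abbreviation D :: "'v set" where
  "D \<equiv> neg_reach G F X"

lemma D_iff:
  "u \<in> D \<longleftrightarrow> u \<in> verts G - X \<and> (\<exists>J\<subseteq>edges G. odd_verts G J - X = {u} \<and> weight F J < 0)"
proof
  assume u: "u \<in> D"
  then have "(INF x\<in>X. join_dist G F x u) < 0" by (simp add: neg_reach_def)
  then obtain x where x: "x \<in> X" "join_dist G F x u < 0" by (auto simp: INF_less_iff)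
  have uX: "u \<in> verts G - X" using u by (simp add: neg_reach_def)
  then have "x \<noteq> u" using x(1) by auto
  then obtain J where J: "J \<subseteq> edges G" "odd_verts G J = {x, u}" "weight F J < 0"
    using x(2) join_dist_less_zero_iff[OF fin conservative_F] by metis
  then have "odd_verts G J - X = {u}" using x(1) uX by auto
  then show "u \<in> verts G - X \<and> (\<exists>J\<subseteq>edges G. odd_verts G J - X = {u} \<and> weight F J < 0)"
    using uX J by blast
next
  assume "u \<in> verts G - X \<and> (\<exists>J\<subseteq>edges G. odd_verts G J - X = {u} \<and> weight F J < 0)"
  then obtain J where u: "u \<in> verts G - X" and
    J: "J \<subseteq> edges G" "odd_verts G J - X = {u}" "weight F J < 0" by blast
  have fJ: "finite J" using J(1) finite_edge_set[OF fin] by blast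
  have "u \<in> odd_verts G J" using J(2) by blast
  then obtain P y where P: "P \<subseteq> J" "y \<noteq> u" "y \<in> odd_verts G J" "odd_verts G P = {u, y}"
    using odd_verts_pair[OF fin J(1)] by metis
  have yX: "y \<in> X" using P(2,3) J(2) by blast
  have "odd_verts G (J - P) \<subseteq> X"
    using odd_verts_Diff[OF fJ P(1), of G] P(4) J(2) yX u by auto
  then have "weight F (J - P) \<ge> 0" using weight_nonneg_X[of "J - P"] J(1) by blast
  then have "weight F P < 0" using weight_Diff[OF fJ P(1), of F] J(3) by simp
  moreover have "odd_verts G P = {y, u}" "P \<subseteq> edges G" using P(1,4) J(1) by auto
  ultimately have "join_dist G F y u < 0"
    using join_dist_less_zero_iff[OF fin conservative_F P(2)] by blast
  then show "u \<in> D" using u yX by (auto simp: neg_reach_def INF_less_iff)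
qed

lemma D_subset: "D \<subseteq> verts G - X"
  by (auto simp: neg_reach_def)

lemma A_subset: "A \<subseteq> X \<union> D"
proof
  fix a assume a: "a \<in> A"
  show "a \<in> X \<union> D"
  proof (rule ccontr)
    assume na: "a \<notin> X \<union> D"
    then have "X \<subset> insert a X" "insert a X \<subseteq> A" using XA a by auto
    then have "\<not> extreme G F (insert a X)"
      using maximal unfolding maximal_bipartitic_extreme_def bipartitic_extreme_def by blast
    then obtain x y where xy: "x \<in> insert a X" "y \<in> insert a X" "join_dist G F x y < 0"
      using XV AB a unfolding extreme_def by (auto simp: not_le)
    have "x \<noteq> y" using xy(3) by (auto simp: join_dist_def)
    then obtain J where J: "J \<subseteq> edges G" "odd_verts G J = {x, y}" "weight F J < 0"
      using xy(3) join_dist_less_zero_iff[OF fin conservative_F] by metis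
    have "\<not> {x, y} \<subseteq> X" using weight_nonneg_X[OF J(1)] J(2,3) by auto
    then have "odd_verts G J - X = {a}" using J(2) xy(1,2) na \<open>x \<noteq> y\<close> by auto
    then have "a \<in> D" using D_iff J(1,3) na a AB by blast
    then show False using na by simp
  qed
qed

lemma D_closed:
  assumes u: "u \<in> D" and e: "e \<in> edges G" "ends G e = {u, v}" and v: "v \<notin> X"
  shows "v \<in> D"
proof (cases "v \<in> A")
  case True
  then show ?thesis using A_subset v by blast
next
  case False
  have V: "u \<in> verts G" "v \<in> verts G" using e fin by (auto simp: finite_mgraph_def)
  have uv: "u \<noteq> v" using edge_distinct[OF e] .
  have uB: "u \<notin> B" "v \<in> B" using False V AB edge_color[OF e] by auto
  obtain J where J: "J \<subseteq> edges G" "odd_verts G J - X = {u}" "weight F J < 0"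
    using u D_iff by blast
  have fJ: "finite J" using J(1) finite_edge_set[OF fin] by blast
  have "X \<inter> B = {}" using XA AB(2) by blast
  moreover have "odd_verts G J \<subseteq> insert u X" using J(2) by (metis Diff_subset_conv Un_commute insert_is_Un subset_refl)
  ultimately have "odd_verts G J \<inter> B = {}" using uB(1) by blast
  then have "even (weight F J)"
    using even_card_bipartition[OF fin J(1) bip] even_weight[OF fJ, of F] by simp
  then have w: "weight F J \<le> -2" using J(3) by presburger
  have uX: "u \<notin> X" using u D_subset by blast
  have "odd_verts G (sym_diff J {e}) = sym_diff (odd_verts G J) {u, v}"
    using odd_verts_sym_diff[OF fJ, of "{e}" G] e by simp
  then have "odd_verts G (sym_diff J {e}) - X = sym_diff (odd_verts G J - X) {u, v}"
    using uX v by auto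
  also have "\<dots> = {v}" using J(2) uv by auto
  finally have "odd_verts G (sym_diff J {e}) - X = {v}" .
  moreover have "weight F (sym_diff J {e}) < 0"
  proof (cases "e \<in> J")
    case True
    then have "sym_diff J {e} = J - {e}" by auto
    then show ?thesis using weight_Diff[OF fJ, of "{e}" F] True w by (auto simp: weight_singleton)
  next
    case False
    then have "sym_diff J {e} = insert e J" by auto
    then show ?thesis using weight_insert[OF fJ False, of F] w by simp
  qed
  moreover have "sym_diff J {e} \<subseteq> edges G" using J(1) e by auto
  ultimately show ?thesis using D_iff V v by blast
qed

lemma F_edge_D:
  assumes "e \<in> F" "ends G e = {x, v}" "x \<in> X" "v \<notin> X"
  shows "v \<in> D"
proof -
  have e: "e \<in> edges G" using assms F_edges by blast
  then have "v \<in> verts G" using fin assms(2) by (auto simp: finite_mgraph_def)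
  moreover have "odd_verts G {e} - X = {v}" "weight F {e} < 0"
    using assms by (auto simp: weight_singleton)
  ultimately show ?thesis using D_iff e assms(4) by (metis DiffI empty_subsetI insert_subset)
qed

lemma outside:
  assumes "b \<in> verts G - X - D" "e \<in> edges G" "ends G e = {b, a}"
  shows "b \<in> B" "a \<in> X" "e \<notin> F"
proof -
  have "b \<notin> A" using assms(1) A_subset by blast
  then show b: "b \<in> B" using assms(1) AB by blast
  have e': "ends G e = {a, b}" using assms(3) by auto
  then have "a \<in> A" using b edge_color[OF assms(2)] by blast
  then show a: "a \<in> X" using A_subset D_closed[OF _ assms(2) e'] assms(1) by blast
  show "e \<notin> F" using F_edge_D[OF _ e' a] assms(1) by blast
qed

lemma outside_not_allowed:
  assumes b: "b \<in> verts G - X - D" and e: "e \<in> edges G" "ends G e = {b, a}"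
  shows "e \<notin> allowed_edges G T"
proof
  assume "e \<in> allowed_edges G T"
  then obtain F' where F': "minimum_join G T F'" "e \<in> F'" by (auto simp: allowed_edges_def)
  have F'E: "F' \<subseteq> edges G" "odd_verts G F' = T" "finite F'"
    using F'(1) is_join_iff[OF fin TV] finite_edge_set[OF fin] by (auto simp: minimum_join_def)
  note o = outside[OF b e]
  have ab: "b \<noteq> a" using edge_distinct[OF e] .
  define M where "M = sym_diff F F'"
  have M: "M \<subseteq> edges G" "odd_verts G M = {}" "e \<in> M" "finite M"
    using F_edges F'E F'(2) o(3) odd_verts_sym_diff[OF fin_F F'E(3), of G] F_odd fin_F
    by (auto simp: M_def)
  have od: "odd_verts G (M - {e}) = {b, a}"
    using odd_verts_Diff[OF M(4), of "{e}" G] M(2,3) e(2) by auto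
  have "M - {e} \<subseteq> edges G" "b \<in> odd_verts G (M - {e})" using M(1) od by auto
  then obtain P y where P: "P \<subseteq> M - {e}" "y \<noteq> b" "y \<in> odd_verts G (M - {e})" "odd_verts G P = {b, y}"
    using odd_verts_pair[OF fin] by metis
  have y: "y = a" using P(2,3) od by blast
  have PE: "P \<subseteq> edges G" "finite P" "e \<notin> P" using P(1) M(1,4) finite_subset by blast+
  define Q where "Q = insert e P"
  have Q: "Q \<subseteq> edges G" "odd_verts G Q = {}" "finite Q" "Q \<subseteq> M"
    using odd_verts_insert[OF PE(2,3), of G] P(1,4) y e PE M(3) by (auto simp: Q_def)
  have "weight F Q \<ge> 0" "weight F' Q \<ge> 0"
    using weight_even_nonneg[OF fin TV min Q(1,2)] weight_even_nonneg[OF fin TV F'(1) Q(1,2)] by blast+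
  moreover have "weight F' Q = - weight F Q"
  proof -
    have "Q - F' = Q \<inter> F" "Q \<inter> F' = Q - F" using Q(4) by (auto simp: M_def)
    then show ?thesis by (simp add: weight_def)
  qed
  ultimately have "weight F Q = 0" by simp
  then have "weight F P < 0" using weight_insert[OF PE(2,3), of F] o(3) by (simp add: Q_def)
  moreover have "odd_verts G P - X = {b}" using P(4) y o(2) b by auto
  ultimately have "b \<in> D" using D_iff b PE(1) by blast
  then show False using b by simp
qed

end

section \<open>A component of the negative region\<close>

text \<open>The graph \<open>H\<close> below is \<open>C\<close> together with \<open>X\<close> contracted to \<open>x0\<close>.\<close>

locale negative_component = maximal_extreme_set +
  fixes C x0
  assumes x0: "x0 \<in> X"
    and CD: "C \<subseteq> D" and C_ne: "C \<noteq> {}"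
    and closed: "\<And>e u v. e \<in> edges G \<Longrightarrow> ends G e = {u, v} \<Longrightarrow> u \<in> C \<Longrightarrow> v \<notin> X \<Longrightarrow> v \<in> C"
    and conn: "cut_connected G C"
begin

definition f :: "'a \<Rightarrow> 'a" where
  "f v = (if v \<in> X then x0 else v)"

definition E\<^sub>C :: "'b set" where
  "E\<^sub>C = {e \<in> edges G. ends G e \<inter> C \<noteq> {}}"

definition H :: "('a, 'b) mgraph" where
  "H = image_graph f E\<^sub>C (induced G (C \<union> X))"

lemma CX: "C \<inter> X = {}" and CV: "C \<subseteq> verts G"
  using CD D_subset by blast+

lemma fin_C: "finite C"
  using CV fin by (auto simp: finite_mgraph_def intro: finite_subset)

lemma E\<^sub>C_ends:
  assumes "e \<in> E\<^sub>C"
  shows "ends G e \<subseteq> C \<union> X"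
proof -
  have e: "e \<in> edges G" using assms by (simp add: E\<^sub>C_def)
  obtain u where u: "u \<in> ends G e" "u \<in> C" using assms by (auto simp: E\<^sub>C_def)
  obtain v where v: "ends G e = {u, v}" using ends_other[OF fin e u(1)] by blast
  have "v \<in> C \<union> X" using closed[OF e v u(2)] by blast
  then show ?thesis using u(2) unfolding v by simp
qed

lemma E\<^sub>C_edges: "E\<^sub>C \<subseteq> edges G" "E\<^sub>C \<subseteq> edges (induced G (C \<union> X))"
  using E\<^sub>C_ends by (auto simp: E\<^sub>C_def edges_induced edges_within_def)

lemma inj_f: "e \<in> edges G \<Longrightarrow> inj_on f (ends G e)"
proof -
  assume e: "e \<in> edges G"
  obtain a b where ab: "ends G e = {a, b}" "a \<in> A" "b \<in> B" using edge_ends[OF e] by metis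
  then have "b \<notin> X" using XA AB by blast
  then have "f a \<noteq> f b" using ab AB x0 by (auto simp: f_def)
  then show ?thesis using ab by auto
qed

lemma verts_H: "verts H = insert x0 C"
  unfolding H_def image_graph_def verts_induced using CX CV XV x0 by (auto simp: f_def)

lemma edges_H: "edges H = E\<^sub>C" and ends_H: "ends H e = f ` ends G e"
  by (simp_all add: H_def image_graph_def)

lemma fin_H: "finite_mgraph H"
  unfolding H_def
  using finite_mgraph_induced[OF fin] E\<^sub>C_edges inj_f by (intro finite_mgraph_image_graph) auto

lemma bip_H: "bipartition H B"
proof -
  have "card (f ` ends G e \<inter> B) = 1" if e: "e \<in> edges G" for e
  proof -
    obtain a b where ab: "ends G e = {a, b}" "a \<in> A" "b \<in> B" using edge_ends[OF e] by metis
    then have "f ` ends G e \<inter> B = {b}" using XA AB x0 by (auto simp: f_def)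
    then show ?thesis by simp
  qed
  then show ?thesis using E\<^sub>C_edges(1) by (auto simp: bipartition_def edges_H ends_H)
qed

lemma odd_H:
  assumes "J \<subseteq> E\<^sub>C" "v \<notin> X"
  shows "v \<in> odd_verts H J \<longleftrightarrow> v \<in> odd_verts G J"
proof -
  have "odd_verts H J = push f (odd_verts G J)"
    unfolding H_def using odd_verts_image_graph_inj[OF finite_mgraph_induced[OF fin], of J "C \<union> X" f E\<^sub>C]
      assms(1) E\<^sub>C_edges inj_f by auto
  moreover have "v \<in> push f (odd_verts G J) \<longleftrightarrow> v \<in> odd_verts G J"
    by (rule push_fibre) (use assms(2) x0 in \<open>auto simp: f_def\<close>)
  ultimately show ?thesis by simp
qed

lemma odd_H_subset: "J \<subseteq> E\<^sub>C \<Longrightarrow> odd_verts H J \<subseteq> insert x0 C"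
  using odd_verts_subset[OF fin_H, of J] verts_H edges_H by simp

lemma odd_H_eqI:
  assumes J: "J \<subseteq> E\<^sub>C" and S: "S \<subseteq> insert x0 C" "even (card S)"
    and eq: "odd_verts H J \<inter> C = S \<inter> C"
  shows "odd_verts H J = S"
proof -
  have x0C: "x0 \<notin> C" using x0 CX by blast
  have e: "even (card (odd_verts H J))" using even_card_odd_verts[OF fin_H] J edges_H by simp
  have fi: "finite S" "finite (odd_verts H J)"
    using S(1) odd_H_subset[OF J] fin_C by (auto intro: finite_subset)
  have c: "card R = card (R \<inter> C) + (if x0 \<in> R then 1 else 0)" if "R \<subseteq> insert x0 C" "finite R" for R
  proof -
    have "R = (R \<inter> C) \<union> (if x0 \<in> R then {x0} else {})" using that by auto
    then have "card R = card ((R \<inter> C) \<union> (if x0 \<in> R then {x0} else {}))" by simp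
    also have "\<dots> = card (R \<inter> C) + card (if x0 \<in> R then {x0} else {})"
      using that x0C by (intro card_Un_disjoint) auto
    finally show ?thesis by simp
  qed
  have "x0 \<in> S \<longleftrightarrow> x0 \<in> odd_verts H J"
    using c[OF S(1) fi(1)] c[OF odd_H_subset[OF J] fi(2)] e S(2) eq by (auto split: if_splits)
  then show ?thesis using eq S(1) odd_H_subset[OF J] by blast
qed

definition F\<^sub>C :: "'b set" where
  "F\<^sub>C = F \<inter> E\<^sub>C"

definition T\<^sub>H :: "'a set" where
  "T\<^sub>H = sym_diff (odd_verts H F\<^sub>C) {x0}"

lemma T\<^sub>H_x0: "sym_diff T\<^sub>H {x0} = odd_verts H F\<^sub>C"
  by (auto simp: T\<^sub>H_def)

lemma T\<^sub>H_sub: "T\<^sub>H \<subseteq> verts H"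
  using odd_H_subset[of F\<^sub>C] by (auto simp: T\<^sub>H_def verts_H F\<^sub>C_def)

lemma odd_local:
  assumes "v \<in> C"
  shows "v \<in> odd_verts G (J \<inter> E\<^sub>C) \<longleftrightarrow> v \<in> odd_verts G (J \<inter> edges G)"
proof -
  have "{e \<in> J \<inter> E\<^sub>C. v \<in> ends G e} = {e \<in> J \<inter> edges G. v \<in> ends G e}"
    using assms by (auto simp: E\<^sub>C_def)
  then show ?thesis by (simp add: odd_verts_def)
qed

lemma T\<^sub>H_C: "v \<in> C \<Longrightarrow> v \<in> T\<^sub>H \<longleftrightarrow> v \<in> T"
proof -
  assume v: "v \<in> C"
  have vx: "v \<notin> X" "v \<noteq> x0" using v CX x0 by auto
  have "F \<inter> edges G = F" using F_edges by blast
  then have "v \<in> odd_verts G F\<^sub>C \<longleftrightarrow> v \<in> T"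
    using odd_local[OF v, of F] F_odd by (simp add: F\<^sub>C_def)
  then show ?thesis using odd_H[of F\<^sub>C v] vx by (simp add: T\<^sub>H_def F\<^sub>C_def)
qed

lemma min_F\<^sub>C: "minimum_join H (sym_diff T\<^sub>H {x0}) F\<^sub>C"
  unfolding T\<^sub>H_x0
proof (rule minimum_joinI_weight[OF fin_H])
  show s: "odd_verts H F\<^sub>C \<subseteq> verts H" using odd_H_subset[of F\<^sub>C] by (simp add: verts_H F\<^sub>C_def)
  show "is_join H (odd_verts H F\<^sub>C) F\<^sub>C"
    using is_join_iff[OF fin_H s] by (simp add: edges_H F\<^sub>C_def)
  fix Z assume Z: "Z \<subseteq> edges H" "odd_verts H Z = {}"
  then have ZE: "Z \<subseteq> E\<^sub>C" by (simp add: edges_H)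
  have "odd_verts G Z \<subseteq> X" using odd_H[OF ZE] Z(2) by auto
  then have "weight F Z \<ge> 0" using weight_nonneg_X[of Z] ZE E\<^sub>C_edges(1) by blast
  moreover have "Z - F\<^sub>C = Z - F" "Z \<inter> F\<^sub>C = Z \<inter> F" using ZE by (auto simp: F\<^sub>C_def)
  ultimately show "weight F\<^sub>C Z \<ge> 0" by (simp add: weight_def)
qed

lemma card_pair: "v \<in> C \<Longrightarrow> card {v, x0} = 2"
  using x0 CX by (metis card_2_iff disjoint_iff)

lemma join_below:
  assumes u: "u \<in> C"
  shows "\<exists>M. is_join H (sym_diff T\<^sub>H {u}) M \<and> card M < card F\<^sub>C"
proof -
  obtain J where J: "J \<subseteq> edges G" "odd_verts G J - X = {u}" "weight F J < 0"
    using D_iff[of u] subsetD[OF CD u] by blast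
  have fJ: "finite J" using J(1) finite_edge_set[OF fin] by blast
  define K where "K = J \<inter> E\<^sub>C"
  have K: "K \<subseteq> E\<^sub>C" "K \<subseteq> J" "finite K" using fJ by (auto simp: K_def)
  have JE: "J \<inter> edges G = J" using J(1) by blast
  have oC: "v \<in> odd_verts G K \<longleftrightarrow> v = u" if v: "v \<in> C" for v
    using odd_local[OF v, of J] JE J(2) v CX by (auto simp: K_def)
  have oK: "odd_verts G K \<subseteq> C \<union> X"
  proof
    fix v assume "v \<in> odd_verts G K"
    then have "{e \<in> K. v \<in> ends G e} \<noteq> {}"
      unfolding odd_verts_def by (metis (mono_tags, lifting) card.empty even_zero mem_Collect_eq)
    then obtain e where "e \<in> K" "v \<in> ends G e" by blast
    then show "v \<in> C \<union> X" using E\<^sub>C_ends[of e] K(1) by blast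
  qed
  have "odd_verts G (J - K) = sym_diff (odd_verts G J) (odd_verts G K)"
    using odd_verts_Diff[OF fJ K(2)] .
  moreover have "odd_verts G J \<subseteq> insert u X" "u \<in> odd_verts G J" using J(2) by auto
  ultimately have "odd_verts G (J - K) \<subseteq> X" using oC oK u by auto
  then have "weight F (J - K) \<ge> 0" using weight_nonneg_X[of "J - K"] J(1) by blast
  then have wK: "weight F K < 0" using weight_Diff[OF fJ K(2), of F] J(3) by simp
  have "K - F\<^sub>C = K - F" "K \<inter> F\<^sub>C = K \<inter> F" using K(1) by (auto simp: F\<^sub>C_def)
  then have w: "weight F\<^sub>C K < 0" using wK by (simp add: weight_def)
  have "v \<in> odd_verts H K \<longleftrightarrow> v \<in> {u, x0}" if "v \<in> C" for v
  proof -
    have "v \<notin> X" "v \<noteq> x0" using that CX x0 by auto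
    then show ?thesis using oC[OF that] odd_H[OF K(1), of v] by simp
  qed
  then have "odd_verts H K \<inter> C = {u, x0} \<inter> C" by auto
  then have oH: "odd_verts H K = {u, x0}"
    using u card_pair[OF u] by (intro odd_H_eqI[OF K(1)]) auto
  have "u \<noteq> x0" using u x0 CX by auto
  then have "sym_diff (sym_diff T\<^sub>H {x0}) {u, x0} = sym_diff T\<^sub>H {u}" by auto
  moreover have "sym_diff T\<^sub>H {x0} \<subseteq> verts H" using T\<^sub>H_sub verts_H by auto
  ultimately have "is_join H (sym_diff T\<^sub>H {u}) (sym_diff F\<^sub>C K)"
    using is_join_switch[OF fin_H, of "sym_diff T\<^sub>H {x0}" F\<^sub>C K] min_F\<^sub>C oH K(1) edges_H
    unfolding minimum_join_def by metis
  moreover have "finite F\<^sub>C" using fin_F by (simp add: F\<^sub>C_def)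
  then have "card (sym_diff F\<^sub>C K) < card F\<^sub>C" using card_sym_diff_weight[of F\<^sub>C K] K(3) w by simp
  ultimately show ?thesis by blast
qed

lemma cut_eq:
  assumes "M \<subseteq> E\<^sub>C"
  shows "{e \<in> M. x0 \<in> ends H e} = edge_cut G C \<inter> M"
proof -
  have "x0 \<in> f ` ends G e \<longleftrightarrow> card (ends G e \<inter> C) = 1" if e: "e \<in> E\<^sub>C" for e
  proof -
    have eE: "e \<in> edges G" using e E\<^sub>C_edges by blast
    obtain u where u: "u \<in> ends G e" "u \<in> C" using e by (auto simp: E\<^sub>C_def)
    then obtain v where v: "ends G e = {u, v}" "u \<noteq> v" using ends_other[OF fin eE] by metis
    have vC: "v \<in> C \<or> v \<in> X" using E\<^sub>C_ends[OF e] v(1) by auto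
    have "x0 \<in> f ` ends G e \<longleftrightarrow> v \<in> X" using v u(2) CX x0 vC by (auto simp: f_def)
    moreover have "ends G e \<inter> C = (if v \<in> X then {u} else {u, v})" using v u(2) vC CX by auto
    then have "card (ends G e \<inter> C) = 1 \<longleftrightarrow> v \<in> X" using v(2) by simp
    ultimately show ?thesis by blast
  qed
  then show ?thesis using assms E\<^sub>C_edges(1) by (auto simp: edge_cut_def ends_H)
qed

lemma edges_at_cut:
  assumes v: "v \<in> insert x0 C" and M: "minimum_join H (sym_diff T\<^sub>H {v}) M"
  shows "card (edge_cut G C \<inter> M) = (if v = x0 then 1 else 0)"
proof -
  have x0C: "verts H - {x0} = C" using verts_H x0 CX by auto
  have "M \<subseteq> E\<^sub>C" using M edges_H by (simp add: minimum_join_def is_join_def)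
  then have "card (edge_cut G C \<inter> M) = card {e \<in> M. x0 \<in> ends H e}" using cut_eq by simp
  also have "\<dots> = (if v = x0 then 1 else 0)"
  proof (rule edges_at_highest_vertex[OF fin_H bip_H T\<^sub>H_sub])
    show "x0 \<in> verts H" "v \<in> verts H" using verts_H v by auto
    show "\<exists>M. is_join H (sym_diff T\<^sub>H {w}) M" if w: "w \<in> verts H" for w
    proof (cases "w = x0")
      case True
      then show ?thesis using min_F\<^sub>C unfolding minimum_join_def by blast
    next
      case False
      then show ?thesis using join_below[of w] w verts_H by blast
    qed
    show "join_number H (sym_diff T\<^sub>H {w}) < join_number H (sym_diff T\<^sub>H {x0})"
      if w: "w \<in> verts H - {x0}" for w
    proof -
      obtain N where "is_join H (sym_diff T\<^sub>H {w}) N" "card N < card F\<^sub>C"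
        using join_below w x0C by blast
      moreover have "card F\<^sub>C = join_number H (sym_diff T\<^sub>H {x0})"
        using min_F\<^sub>C minimum_join_iff by metis
      ultimately show ?thesis using join_number_le[of H "sym_diff T\<^sub>H {w}" N] by simp
    qed
    show "verts H - {x0} \<noteq> {}" using x0C C_ne by simp
    show "minimum_join H (sym_diff T\<^sub>H {v}) M" by (rule M)
    show "cut_connected H (verts H - {x0})"
      unfolding cut_connected_def x0C
    proof (intro allI impI)
      fix Y assume Y: "Y \<subseteq> C" "Y \<noteq> {}" "Y \<noteq> C"
      then obtain e where e: "e \<in> edges G" "ends G e \<inter> Y \<noteq> {}" "ends G e \<inter> (C - Y) \<noteq> {}"
        using conn unfolding cut_connected_def by blast
      have "R \<inter> ends G e \<subseteq> f ` ends G e" if "R \<subseteq> C" for R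
        using that CX by (force simp: f_def)
      then have "ends H e \<inter> Y \<noteq> {} \<and> ends H e \<inter> (C - Y) \<noteq> {}"
        using e(2,3) Y(1) unfolding ends_H by blast
      moreover have "e \<in> edges H" using e Y(1) by (auto simp: edges_H E\<^sub>C_def)
      ultimately show "\<exists>e\<in>edges H. ends H e \<inter> Y \<noteq> {} \<and> ends H e \<inter> (C - Y) \<noteq> {}" by blast
    qed
  qed
  finally show ?thesis .
qed

lemma one_cut_edge: "card (edge_cut G C \<inter> F) = 1"
proof -
  have "edge_cut G C \<inter> F = edge_cut G C \<inter> F\<^sub>C"
    by (auto simp: F\<^sub>C_def E\<^sub>C_def edge_cut_def card_1_singleton_iff)
  then show ?thesis using edges_at_cut[OF _ min_F\<^sub>C] by simp
qed

lemma odd_component: "odd (card (C \<inter> T))"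
  using even_card_edge_cut[OF fin F_edges, of C] F_odd one_cut_edge by (simp add: Int_commute)

end

context negative_component
begin

lemma edges_within_C: "edges_within G C \<subseteq> E\<^sub>C"
proof
  fix e assume e: "e \<in> edges_within G C"
  then have "card (ends G e) = 2" using fin by (simp add: edges_within_def finite_mgraph_def)
  then have "ends G e \<noteq> {}" by auto
  then show "e \<in> E\<^sub>C" using e by (auto simp: edges_within_def E\<^sub>C_def)
qed

lemma edges_within_C_iff:
  assumes "e \<in> E\<^sub>C"
  shows "e \<in> edges_within G C \<longleftrightarrow> e \<notin> edge_cut G C"
proof -
  have eE: "e \<in> edges G" using assms by (simp add: E\<^sub>C_def)
  obtain u where u: "u \<in> ends G e" "u \<in> C" using assms by (auto simp: E\<^sub>C_def)
  then obtain v where v: "ends G e = {u, v}" "u \<noteq> v" using ends_other[OF fin eE] by metis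
  show ?thesis
  proof (cases "v \<in> C")
    case True
    then have "ends G e \<inter> C = {u, v}" using v u by auto
    then show ?thesis using v u True eE by (simp add: edges_within_def edge_cut_def)
  next
    case False
    then have "ends G e \<inter> C = {u}" using v u by auto
    then show ?thesis using v u False eE by (simp add: edges_within_def edge_cut_def)
  qed
qed

lemma odd_within:
  assumes "J \<subseteq> edges_within G C"
  shows "odd_verts G J \<subseteq> C"
  using odd_verts_subset[OF finite_mgraph_induced[OF fin], of J C] assms
  by (simp add: edges_induced verts_induced)

context
  fixes r e\<^sub>0
  assumes r: "r \<in> C" "r \<in> ends G e\<^sub>0" and cut: "edge_cut G C \<inter> F = {e\<^sub>0}"
begin

abbreviation S where "S \<equiv> sym_diff (T \<inter> C) {r}"

lemma fin_IC: "finite_mgraph (induced G C)"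
  by (rule finite_mgraph_induced[OF fin])

lemma S_sub: "S \<subseteq> verts (induced G C)"
  using r(1) CV by (auto simp: verts_induced)

lemma e\<^sub>0: "e\<^sub>0 \<in> F" "e\<^sub>0 \<in> E\<^sub>C" "e\<^sub>0 \<in> edge_cut G C"
proof -
  show 1: "e\<^sub>0 \<in> F" "e\<^sub>0 \<in> edge_cut G C" using cut by auto
  then show "e\<^sub>0 \<in> E\<^sub>C" using F_edges r by (auto simp: E\<^sub>C_def)
qed

lemma within_F: "F \<inter> edges_within G C = F\<^sub>C - {e\<^sub>0}"
proof -
  have "e \<in> edge_cut G C \<longleftrightarrow> e = e\<^sub>0" if "e \<in> F" for e using cut that by auto
  then show ?thesis using edges_within_C edges_within_C_iff by (auto simp: F\<^sub>C_def)
qed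

lemma card_F\<^sub>C: "card F\<^sub>C = Suc (card (F \<inter> edges_within G C))"
proof -
  have "finite F\<^sub>C" "e\<^sub>0 \<in> F\<^sub>C" using fin_F e\<^sub>0 by (auto simp: F\<^sub>C_def)
  then show ?thesis unfolding within_F by (metis card_Suc_Diff1)
qed

lemma odd_within_F: "odd_verts G (F \<inter> edges_within G C) = S"
proof -
  have f: "finite F\<^sub>C" "e\<^sub>0 \<in> F\<^sub>C" using fin_F e\<^sub>0 by (auto simp: F\<^sub>C_def)
  have e0E: "e\<^sub>0 \<in> edges G" using e\<^sub>0 F_edges by blast
  obtain x where x: "ends G e\<^sub>0 = {r, x}" "r \<noteq> x" using ends_other[OF fin e0E r(2)] by metis
  have "x \<notin> C"
  proof
    assume "x \<in> C"
    then have "e\<^sub>0 \<in> edges_within G C" using x r(1) e0E by (simp add: edges_within_def)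
    then show False using edges_within_C_iff[OF e\<^sub>0(2)] e\<^sub>0(3) by simp
  qed
  have "odd_verts G (F \<inter> edges_within G C) = sym_diff (odd_verts G F\<^sub>C) {r, x}"
    unfolding within_F using odd_verts_Diff[OF f(1), of "{e\<^sub>0}" G] f(2) x(1) by simp
  moreover have "v \<in> odd_verts G F\<^sub>C \<longleftrightarrow> v \<in> T" if v: "v \<in> C" for v
  proof -
    have "F \<inter> edges G = F" using F_edges by blast
    then show ?thesis using odd_local[OF v, of F] F_odd by (simp add: F\<^sub>C_def)
  qed
  ultimately have "v \<in> odd_verts G (F \<inter> edges_within G C) \<longleftrightarrow> v \<in> S" if "v \<in> C" for v
    using that \<open>x \<notin> C\<close> by auto
  moreover have "odd_verts G (F \<inter> edges_within G C) \<subseteq> C" by (rule odd_within) simp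
  moreover have "S \<subseteq> C" using r(1) by auto
  ultimately show ?thesis by blast
qed

lemma min_within: "minimum_join (induced G C) S (F \<inter> edges_within G C)"
proof (rule minimum_joinI_weight[OF fin_IC S_sub])
  show "is_join (induced G C) S (F \<inter> edges_within G C)"
    using is_join_iff[OF fin_IC S_sub] odd_within_F by (simp add: edges_induced)
  fix Z assume Z: "Z \<subseteq> edges (induced G C)" "odd_verts (induced G C) Z = {}"
  then have ZC: "Z \<subseteq> edges_within G C" by (simp add: edges_induced)
  then have "weight F Z \<ge> 0"
    using conservative_F Z(2) edges_within_C E\<^sub>C_edges(1) unfolding conservative_def by simp
  moreover have "Z - F \<inter> edges_within G C = Z - F" "Z \<inter> (F \<inter> edges_within G C) = Z \<inter> F"
    using ZC by auto
  ultimately show "weight (F \<inter> edges_within G C) Z \<ge> 0" by (simp add: weight_def)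
qed

lemma min_within_props:
  assumes "minimum_join (induced G C) S F'"
  shows "F' \<subseteq> edges_within G C" "odd_verts G F' = S" "finite F'" "card F\<^sub>C = Suc (card F')"
    "conservative (induced G C) F'"
proof -
  show 1: "F' \<subseteq> edges_within G C" "odd_verts G F' = S"
    using assms is_join_iff[OF fin_IC S_sub] by (auto simp: minimum_join_def edges_induced)
  show "finite F'" using finite_edge_set[OF fin_IC] 1 by (simp add: edges_induced)
  have "card F' = card (F \<inter> edges_within G C)"
    using assms min_within minimum_join_iff by metis
  then show "card F\<^sub>C = Suc (card F')" using card_F\<^sub>C by simp
  show "conservative (induced G C) F'"
    unfolding conservative_def using weight_even_nonneg[OF fin_IC S_sub assms] by blast
qed

lemma join_dist_le_zero:
  assumes F': "minimum_join (induced G C) S F'" and u: "u \<in> C"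
  shows "join_dist (induced G C) F' r u \<le> 0"
proof (cases "u = r")
  case True
  then show ?thesis by (simp add: join_dist_def)
next
  case False
  note p = min_within_props[OF F']
  obtain N where N: "is_join H (sym_diff T\<^sub>H {u}) N" "card N < card F\<^sub>C" using join_below[OF u] by blast
  obtain M where M: "minimum_join H (sym_diff T\<^sub>H {u}) M" using obtains_minimum_join[OF N(1)] by metis
  have ux: "u \<noteq> x0" "u \<notin> X" using u x0 CX by auto
  have "card M \<le> card N" using M N(1) by (simp add: minimum_join_def)
  then have cM: "card M \<le> card F'" using N(2) p(4) by simp
  have "sym_diff T\<^sub>H {u} \<subseteq> verts H" using T\<^sub>H_sub u verts_H by auto
  then have ME: "M \<subseteq> E\<^sub>C" and Mo: "odd_verts H M = sym_diff T\<^sub>H {u}"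
    using M is_join_iff[OF fin_H] edges_H by (auto simp: minimum_join_def)
  have fM: "finite M" using ME finite_edge_set[OF fin_H] edges_H by simp
  have "card (edge_cut G C \<inter> M) = 0" using edges_at_cut[OF _ M] u ux by simp
  then have "edge_cut G C \<inter> M = {}" using fM by simp
  then have MC: "M \<subseteq> edges_within G C" using ME edges_within_C_iff by blast
  have "v \<in> odd_verts G M \<longleftrightarrow> v \<in> sym_diff (T \<inter> C) {u}" if v: "v \<in> C" for v
  proof -
    have "v \<notin> X" using v CX by blast
    then show ?thesis using odd_H[OF ME, of v] Mo T\<^sub>H_C[OF v] v by simp
  qed
  moreover have "sym_diff (T \<inter> C) {u} \<subseteq> C" using u by auto
  ultimately have oM: "odd_verts G M = sym_diff (T \<inter> C) {u}" using odd_within[OF MC] by blast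
  define J where "J = sym_diff F' M"
  have "odd_verts G J = sym_diff S (sym_diff (T \<inter> C) {u})"
    unfolding J_def using odd_verts_sym_diff[OF p(3) fM, of G] p(2) oM by simp
  also have "\<dots> = {r, u}" using False by auto
  finally have oJ: "odd_verts (induced G C) J = {r, u}" by simp
  have JE: "J \<subseteq> edges (induced G C)" using p(1) MC by (auto simp: J_def edges_induced)
  have "sym_diff F' J = M" "finite J" using p(3) fM by (auto simp: J_def)
  then have "weight F' J \<le> 0" using card_sym_diff_weight[OF p(3), of J] cM by simp
  then have "ereal (of_int (weight F' J)) \<le> 0" by (simp add: zero_ereal_def)
  moreover have "join_dist (induced G C) F' r u \<le> ereal (of_int (weight F' J))"
    using join_dist_le[OF fin_IC p(5) JE oJ] False by simp
  ultimately show ?thesis by (rule order_trans[rotated])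
qed

lemma join_dist_nbhd:
  assumes F': "minimum_join (induced G C) S F'" and c: "c \<in> nbhd G X" "c \<in> C"
  shows "join_dist (induced G C) F' r c = 0"
proof (cases "c = r")
  case True
  then show ?thesis by (simp add: join_dist_def)
next
  case False
  note p = min_within_props[OF F']
  obtain x g where g: "x \<in> X" "g \<in> edges G" "ends G g = {x, c}" using c(1) by (auto simp: nbhd_def)
  have "ereal (of_int 0) \<le> join_dist (induced G C) F' r c"
  proof (rule join_dist_ge)
    show "r \<noteq> c" using False by simp
    fix J assume J: "J \<subseteq> edges (induced G C)" "odd_verts (induced G C) J = {r, c}"
    then have JC: "J \<subseteq> edges_within G C" "odd_verts G J = {r, c}" by (auto simp: edges_induced)
    have fJ: "finite J" using finite_edge_set[OF fin_IC J(1)] .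
    show "0 \<le> weight F' J"
    proof (rule ccontr)
      assume "\<not> 0 \<le> weight F' J"
      define N where "N = sym_diff F' J"
      have NC: "N \<subseteq> edges_within G C" "finite N" using p(1,3) JC(1) fJ by (auto simp: N_def)
      have cN: "card N < card F'"
        using card_sym_diff_weight[OF p(3) fJ] \<open>\<not> 0 \<le> weight F' J\<close> by (simp add: N_def)
      have "odd_verts G N = sym_diff S {r, c}"
        unfolding N_def using odd_verts_sym_diff[OF p(3) fJ, of G] p(2) JC(2) by simp
      also have "\<dots> = sym_diff (T \<inter> C) {c}" using False by auto
      finally have oN: "odd_verts G N = sym_diff (T \<inter> C) {c}" .
      have xC: "x \<notin> C" using g(1) CX by blast
      have gN: "g \<notin> N" using NC(1) g(3) xC by (auto simp: edges_within_def)
      have gE: "insert g N \<subseteq> E\<^sub>C" using NC(1) edges_within_C g(2,3) c(2) by (auto simp: E\<^sub>C_def)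
      have o: "odd_verts G (insert g N) = sym_diff (sym_diff (T \<inter> C) {c}) {x, c}"
        using odd_verts_insert[OF NC(2) gN, of G] oN g(3) by simp
      have "odd_verts H (insert g N) = odd_verts H F\<^sub>C"
      proof (rule odd_H_eqI[OF gE])
        show "odd_verts H F\<^sub>C \<subseteq> insert x0 C" by (rule odd_H_subset) (simp add: F\<^sub>C_def)
        show "even (card (odd_verts H F\<^sub>C))"
          by (rule even_card_odd_verts[OF fin_H]) (simp add: F\<^sub>C_def edges_H)
        have "v \<in> odd_verts H (insert g N) \<longleftrightarrow> v \<in> odd_verts H F\<^sub>C" if v: "v \<in> C" for v
        proof -
          have vX: "v \<notin> X" "v \<noteq> x0" "v \<noteq> x" using v CX x0 g(1) by auto
          have "v \<in> odd_verts H (insert g N) \<longleftrightarrow> v \<in> T"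
            using odd_H[OF gE vX(1)] o v vX(3) by auto
          moreover have "v \<in> odd_verts H F\<^sub>C \<longleftrightarrow> v \<in> T"
            using T\<^sub>H_C[OF v] vX(2) by (simp add: T\<^sub>H_def)
          ultimately show ?thesis by simp
        qed
        then show "odd_verts H (insert g N) \<inter> C = odd_verts H F\<^sub>C \<inter> C" by auto
      qed
      moreover have sub: "sym_diff T\<^sub>H {x0} \<subseteq> verts H" using T\<^sub>H_sub verts_H by auto
      ultimately have "is_join H (sym_diff T\<^sub>H {x0}) (insert g N)"
        using is_join_iff[OF fin_H sub] gE edges_H T\<^sub>H_x0 by simp
      then have "card F\<^sub>C \<le> card (insert g N)" using min_F\<^sub>C by (simp add: minimum_join_def)
      then show False using cN p(4) NC(2) gN by simp
    qed
  qed
  then have "0 \<le> join_dist (induced G C) F' r c" by (simp add: zero_ereal_def)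
  then show ?thesis using join_dist_le_zero[OF F' c(2)] by (rule antisym[rotated])
qed

lemma primal_component: "primal (induced G C) S r"
proof -
  have "verts (induced G C) = C" using CV by (auto simp: verts_induced)
  then show ?thesis
    unfolding primal_def graft_def
    using fin_IC S_sub r(1) min_within join_dist_le_zero by auto
qed

lemma nbhd_zero_set: "nbhd G X \<inter> C \<subseteq> zero_set (induced G C) S r"
  using join_dist_nbhd CV by (auto simp: zero_set_def verts_induced)

end

end

section \<open>Components after deleting the extreme set\<close>

context maximal_extreme_set
begin

abbreviation GX where "GX \<equiv> delete_verts G X"

lemma verts_GX: "verts GX = verts G - X"
  by (auto simp: delete_verts_def verts_induced)

lemma edges_GX: "e \<in> edges GX \<longleftrightarrow> e \<in> edges G \<and> ends G e \<inter> X = {}"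
  using fin by (auto simp: delete_verts_def edges_induced edges_within_def finite_mgraph_def)

lemma ends_GX [simp]: "ends GX = ends G"
  by (simp add: delete_verts_def)

lemma fin_GX: "finite_mgraph GX"
  unfolding delete_verts_def by (rule finite_mgraph_induced[OF fin])

lemma reach_GX_D:
  assumes "x \<in> D"
  shows "reach GX x \<subseteq> D"
proof (rule reach_subset[OF assms])
  fix u v e assume "u \<in> D" "e \<in> edges GX" "ends GX e = {u, v}"
  then show "v \<in> D" using D_closed[of u e v] edges_GX[of e] by simp
qed

lemma reach_GX_outside:
  assumes b: "b \<in> verts G - X - D"
  shows "reach GX b = {b}"
proof -
  have "reach GX b \<subseteq> {b}"
  proof (rule reach_subset)
    fix u v e assume "u \<in> {b}" "e \<in> edges GX" "ends GX e = {u, v}"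
    then have "e \<in> edges G" "ends G e = {b, v}" "v \<notin> X" using edges_GX[of e] by auto
    then show "v \<in> {b}" using outside(2)[OF b] by blast
  qed simp
  then show ?thesis using reach_refl[of b GX] by blast
qed

lemma reach_D:
  assumes "x \<in> D"
  shows "reach (induced G D) x = reach GX x"
proof (rule antisym)
  show "reach (induced G D) x \<subseteq> reach GX x"
  proof (rule reach_subset[OF reach_refl])
    fix u v e assume u: "u \<in> reach GX x" and e: "e \<in> edges (induced G D)" "ends (induced G D) e = {u, v}"
    then have "e \<in> edges GX" using D_subset by (auto simp: edges_GX edges_induced edges_within_def)
    then show "v \<in> reach GX x" using reach_step[OF u, of e v] e(2) by simp
  qed
  have "reach GX x \<subseteq> reach (induced G D) x \<inter> D"
  proof (rule reach_subset)
    fix u v e assume u: "u \<in> reach (induced G D) x \<inter> D" and e: "e \<in> edges GX" "ends GX e = {u, v}"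
    have e': "e \<in> edges G" "ends G e = {u, v}" "v \<notin> X" using e edges_GX[of e] by auto
    have v: "v \<in> D" using D_closed[OF _ e'] u by blast
    then have "e \<in> edges (induced G D)" using e' u by (simp add: edges_induced edges_within_def)
    then show "v \<in> reach (induced G D) x \<inter> D" using reach_step[of u "induced G D" x e v] u v e'(2) by simp
  next
    show "x \<in> reach (induced G D) x \<inter> D" using assms reach_refl[of x "induced G D"] by blast
  qed
  then show "reach GX x \<subseteq> reach (induced G D) x" by blast
qed

lemma induced_GX: "Y \<inter> X = {} \<Longrightarrow> induced GX Y = induced G Y"
proof -
  assume Y: "Y \<inter> X = {}"
  have "edges_within GX Y = edges_within G Y" using Y edges_GX by (auto simp: edges_within_def)
  moreover have "verts GX \<inter> Y = verts G \<inter> Y" using Y verts_GX by auto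
  ultimately show ?thesis by (simp add: induced_def delete_verts_def)
qed

lemma induced_D: "Y \<subseteq> D \<Longrightarrow> induced (induced G D) Y = induced G Y"
proof -
  assume Y: "Y \<subseteq> D"
  have "edges_within (induced G D) Y = edges_within G Y"
    using Y by (auto simp: edges_within_def edges_induced)
  moreover have "verts (induced G D) \<inter> Y = verts G \<inter> Y" using Y by (auto simp: verts_induced)
  ultimately show ?thesis by (simp add: induced_def)
qed

lemma component_D:
  assumes x: "x \<in> D"
  shows "\<exists>x0. negative_component G T A B X F (reach GX x) x0"
proof -
  have "(INF x'\<in>X. join_dist G F x' x) < 0" using x by (simp add: neg_reach_def)
  then have "X \<noteq> {}" by (auto simp: INF_less_iff)
  then obtain x0 where x0: "x0 \<in> X" by blast
  have "negative_component G T A B X F (reach GX x) x0"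
  proof (unfold_locales)
    show "x0 \<in> X" by (rule x0)
    show "reach GX x \<subseteq> D" by (rule reach_GX_D[OF x])
    show "reach GX x \<noteq> {}" using reach_refl[of x GX] by blast
  next
    fix e u v assume e: "e \<in> edges G" "ends G e = {u, v}" and u: "u \<in> reach GX x" and v: "v \<notin> X"
    have "u \<notin> X" using u reach_GX_D[OF x] D_subset by blast
    then have "e \<in> edges GX" using e v by (simp add: edges_GX)
    then show "v \<in> reach GX x" using reach_step[OF u, of e v] e(2) by simp
  next
    show "cut_connected G (reach GX x)"
      unfolding cut_connected_def
    proof (intro allI impI)
      fix Y assume Y: "Y \<subseteq> reach GX x" "Y \<noteq> {}" "Y \<noteq> reach GX x"
      then obtain y where y: "y \<in> Y" by blast
      show "\<exists>e\<in>edges G. ends G e \<inter> Y \<noteq> {} \<and> ends G e \<inter> (reach GX x - Y) \<noteq> {}"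
      proof (rule ccontr)
        assume no: "\<not> (\<exists>e\<in>edges G. ends G e \<inter> Y \<noteq> {} \<and> ends G e \<inter> (reach GX x - Y) \<noteq> {})"
        have "reach GX y \<subseteq> Y"
        proof (rule reach_subset[OF y])
          fix u v e assume u: "u \<in> Y" and e: "e \<in> edges GX" "ends GX e = {u, v}"
          have "u \<in> reach GX x" using u Y(1) by blast
          then have "v \<in> reach GX x" using reach_step e by metis
          moreover have "e \<in> edges G" "ends G e = {u, v}" using e edges_GX[of e] by auto
          ultimately show "v \<in> Y" using no u by blast
        qed
        moreover have "reach GX y = reach GX x" using y Y(1) by (intro reach_eq) blast
        ultimately show False using Y(1,3) by blast
      qed
    qed
  qed
  then show ?thesis by blast
qed

lemma component_cases:
  assumes "K \<in> components GX"
  obtains (neg) x where "x \<in> D" "K = induced G (reach GX x)" "verts K = reach GX x"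
  | (outside) b where "b \<in> verts G - X - D" "K = induced G {b}" "verts K = {b}"
proof -
  obtain x where x: "x \<in> verts GX" "K = induced GX (reach GX x)"
    using assms components_eq_reach[OF fin_GX] by auto
  show ?thesis
  proof (cases "x \<in> D")
    case True
    have s: "reach GX x \<subseteq> verts G - X" using reach_GX_D[OF True] D_subset by blast
    then have "K = induced G (reach GX x)" using x(2) induced_GX[of "reach GX x"] by blast
    moreover have "verts G \<inter> reach GX x = reach GX x" using s by blast
    ultimately show ?thesis using neg True by (simp add: verts_induced)
  next
    case False
    then have b: "x \<in> verts G - X - D" using x(1) verts_GX by blast
    then have "K = induced G {x}" using x(2) reach_GX_outside[OF b] induced_GX[of "{x}"] by simp
    then show ?thesis using outside[of x] b by (simp add: verts_induced)
  qed
qed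

lemma edge_cut_outside:
  assumes "b \<in> verts G - X - D"
  shows "edge_cut G {b} \<inter> F = {}"
proof -
  have "e \<notin> F" if e: "e \<in> edge_cut G {b}" for e
  proof -
    have eE: "e \<in> edges G" using e by (simp add: edge_cut_def)
    have "card (ends G e \<inter> {b}) = 1" using e by (simp add: edge_cut_def)
    then have "ends G e \<inter> {b} \<noteq> {}" by (metis card.empty zero_neq_one)
    then have "b \<in> ends G e" by blast
    then obtain a where "ends G e = {b, a}" using ends_other[OF fin eE] by metis
    then show ?thesis using outside(3)[OF assms eE] by blast
  qed
  then show ?thesis by blast
qed

lemma outside_even:
  assumes "b \<in> verts G - X - D"
  shows "even (card ({b} \<inter> T))"
  using even_card_edge_cut[OF fin F_edges, of "{b}"] F_odd edge_cut_outside[OF assms]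
  by (simp add: Int_commute)

lemma trivial_outside:
  assumes b: "b \<in> verts G - X - D"
  shows "trivial_factor_component G T (induced G {b})"
proof -
  let ?A = "G\<lparr>edges := allowed_edges G T\<rparr>"
  have no: "\<not> (e \<in> allowed_edges G T \<and> b \<in> ends G e)" for e
  proof
    assume e: "e \<in> allowed_edges G T \<and> b \<in> ends G e"
    then have eE: "e \<in> edges G" by (simp add: allowed_edges_def)
    then obtain a where "ends G e = {b, a}" using ends_other[OF fin eE] e by metis
    then show False using outside_not_allowed[OF b eE] e by blast
  qed
  have fA: "finite_mgraph ?A"
    using fin by (auto simp: finite_mgraph_def allowed_edges_def)
  have "reach ?A b \<subseteq> {b}"
  proof (rule reach_subset)
    fix u v e assume "u \<in> {b}" "e \<in> edges ?A" "ends ?A e = {u, v}"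
    then show "v \<in> {b}" using no[of e] by simp
  qed simp
  then have "reach ?A b = {b}" using reach_refl[of b ?A] by blast
  then have "induced ?A {b} \<in> components ?A" using components_eq_reach[OF fA] b by force
  moreover have "induced ?A {b} = induced G {b}"
  proof -
    have n: "\<not> ends G e \<subseteq> {b}" if "e \<in> edges G" for e
    proof
      assume "ends G e \<subseteq> {b}"
      then have "card (ends G e) \<le> card {b}" by (intro card_mono) auto
      then show False using that fin by (auto simp: finite_mgraph_def)
    qed
    have "edges_within ?A {b} = {}" "edges_within G {b} = {}"
      using n unfolding edges_within_def allowed_edges_def by auto
    then show ?thesis by (simp add: induced_def)
  qed
  ultimately show ?thesis
    using b by (simp add: trivial_factor_component_def factor_components_def verts_induced)
qed

lemma odd_components_GX: "odd_components T GX = {induced G (reach GX x) | x. x \<in> D}"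
proof (intro equalityI subsetI)
  fix K assume K: "K \<in> odd_components T GX"
  then have K': "K \<in> components GX" "odd (card (verts K \<inter> T))" by (auto simp: odd_components_def)
  from K'(1) show "K \<in> {induced G (reach GX x) | x. x \<in> D}"
  proof (cases rule: component_cases)
    case (neg x)
    then show ?thesis by blast
  next
    case (outside b)
    then show ?thesis using K'(2) outside_even[of b] by simp
  qed
next
  fix K assume "K \<in> {induced G (reach GX x) | x. x \<in> D}"
  then obtain x where x: "x \<in> D" "K = induced G (reach GX x)" by blast
  obtain x0 where "negative_component G T A B X F (reach GX x) x0" using component_D[OF x(1)] by blast
  then interpret C: negative_component G T A B X F "reach GX x" x0 .
  have "verts K = reach GX x" using x(2) C.CV by (auto simp: verts_induced)
  moreover have "K = induced GX (reach GX x)" using x(2) induced_GX C.CX by metis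
  moreover have "x \<in> verts GX" using x(1) D_subset verts_GX by blast
  ultimately show "K \<in> odd_components T GX"
    using C.odd_component components_eq_reach[OF fin_GX] by (auto simp: odd_components_def)
qed

lemma even_componentsE:
  assumes "K \<in> even_components T GX"
  obtains b where "b \<in> verts G - X - D" "K = induced G {b}" "verts K = {b}"
proof -
  have K: "K \<in> components GX" "even (card (verts K \<inter> T))"
    using assms by (auto simp: even_components_def)
  from K(1) show ?thesis
  proof (cases rule: component_cases)
    case (neg x)
    then have "K \<in> odd_components T GX" using odd_components_GX by blast
    then show ?thesis using K(2) by (simp add: odd_components_def)
  next
    case (outside b)
    then show ?thesis using that by blast
  qed
qed

lemma components_D: "components (induced G D) = odd_components T GX"
proof -
  have vD: "verts (induced G D) = D" using D_subset by (auto simp: verts_induced)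
  have "induced (induced G D) (reach (induced G D) x) = induced G (reach GX x)" if "x \<in> D" for x
    using reach_D[OF that] induced_D[OF reach_GX_D[OF that]] by simp
  then have "(\<lambda>x. induced (induced G D) (reach (induced G D) x)) ` D = (\<lambda>x. induced G (reach GX x)) ` D"
    by (rule image_cong[OF refl])
  then show ?thesis
    unfolding odd_components_GX components_eq_reach[OF finite_mgraph_induced[OF fin]] vD
      Setcompr_eq_image by (simp only: Collect_mem_eq)
qed

end

theorem theorem7p4:
  fixes G :: "('v, 'e) mgraph"
    and T A B X :: "'v set"
    and F :: "'e set"
  assumes "bipartite_graft G T A B"
    and "minimum_join G T F"
    and "X \<subseteq> A"
    and "maximal_bipartitic_extreme G A B F X"
  shows "combic G T F X
    \<and> components (induced G (neg_reach G F X)) = odd_components T (delete_verts G X)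
    \<and> (\<forall>C\<in>odd_components T (delete_verts G X). \<forall>r\<in>verts C. \<forall>e.
         edge_cut G (verts C) \<inter> F = {e} \<and> r \<in> ends G e \<longrightarrow>
           primal C (sym_diff (T \<inter> verts C) {r}) r
           \<and> nbhd G X \<inter> verts C \<subseteq> zero_set C (sym_diff (T \<inter> verts C) {r}) r)
    \<and> (\<forall>C\<in>even_components T (delete_verts G X). trivial_factor_component G T C)"
proof -
  interpret maximal_extreme_set G T A B X F
    using assms by unfold_locales
  have comp: "\<exists>x0 Y. negative_component G T A B X F Y x0 \<and> K = induced G Y \<and> verts K = Y"
    if K: "K \<in> odd_components T GX" for K
  proof -
    obtain x where x: "x \<in> D" "K = induced G (reach GX x)"
      using K unfolding odd_components_GX by blast
    obtain x0 where n: "negative_component G T A B X F (reach GX x) x0" using component_D[OF x(1)] by blast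
    then interpret C: negative_component G T A B X F "reach GX x" x0 .
    have "verts K = reach GX x" using x(2) C.CV by (auto simp: verts_induced)
    then show ?thesis using n x(2) by blast
  qed
  have "edges_within G X \<inter> F = {}"
  proof -
    have "e \<notin> edges_within G X" if e: "e \<in> edges G" for e
    proof -
      obtain a b where "ends G e = {a, b}" "b \<in> B" using edge_ends[OF e] by metis
      then show ?thesis using XA AB by (auto simp: edges_within_def)
    qed
    then show ?thesis using F_edges by blast
  qed
  moreover have "card (edge_cut G (verts K) \<inter> F) = 1" if "K \<in> odd_components T GX" for K
    using comp[OF that] negative_component.one_cut_edge by metis
  moreover have "edge_cut G (verts K) \<inter> F = {}" if "K \<in> even_components T GX" for K
    using even_componentsE[OF that] edge_cut_outside by metis
  ultimately have "combic G T F X" by (simp add: combic_def)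
  moreover have "primal K (sym_diff (T \<inter> verts K) {r}) r
      \<and> nbhd G X \<inter> verts K \<subseteq> zero_set K (sym_diff (T \<inter> verts K) {r}) r"
    if K: "K \<in> odd_components T GX" and r: "r \<in> verts K" and e: "edge_cut G (verts K) \<inter> F = {e} \<and> r \<in> ends G e"
    for K r e
  proof -
    obtain x0 Y where Y: "negative_component G T A B X F Y x0" "K = induced G Y" "verts K = Y"
      using comp[OF K] by blast
    interpret C: negative_component G T A B X F Y x0 by (rule Y(1))
    have "r \<in> Y" "r \<in> ends G e" "edge_cut G Y \<inter> F = {e}" using r e Y(3) by auto
    then show ?thesis using C.primal_component[of r e] C.nbhd_zero_set[of r e] Y(2,3) by simp
  qed
  moreover have "trivial_factor_component G T K" if "K \<in> even_components T GX" for K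
    using even_componentsE[OF that] trivial_outside by metis
  ultimately show ?thesis using components_D by blast
qed

end
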